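(* Let $(r,\ell)$ be a pair of integers such that either (1) $r=1$ and $\ell\ge 2$ is arbitrary, or (2) $r\ge 1$ is arbitrary and $\ell=2$. Let $\gamma=\gamma(A_r,\ell)$, let $\mu_\gamma$ be its cluster transformation, let $\eta$ be the unique positive real solution of $\mu_\gamma(y)=y$, and let $J_\gamma(y)$ be the Jacobian matrix of $\mu_\gamma$. Then $$\det\bigl(xI-J_\gamma(\eta)\bigr)=\frac{N_{A_r,\ell}(x)}{D_{A_r,\ell}(x)} .$$
   Context: **Quiver mutation.** Quivers are finite directed multigraphs on a vertex set $\mathbf I$ without 1-loops and 2-cycles; $Q_{ij}$ is the number of arrows from $i$ to $j$. The mutation $\mu_k$ at a vertex $k$ transforms $Q$ as follows: (i) for each path $i\to k\to j$ add an arrow $i\to j$; (ii) reverse all arrows incident to $k$; (iii) remove all 2-cycles. **$Y$-seed mutation.** A $Y$-seed is a pair $(Q,Y)$ with $Y=(Y_i)_{i\in\mathbf I}$ a tuple of subtraction-free rational functions over $\mathbb Q$ in variables $y=(y_i)_{i\in\mathbf I}$. Then $\mu_k(Q,Y)=(\mu_k(Q),\widetilde Y)$ where $\widetilde Y_k=Y_k^{-1}$, and for $i\ne k$: $\widetilde Y_i=Y_i(Y_k^{-1}+1)^{-Q_{ki}}$ if $Q_{ki}\ge 0$ and $Q_{ik}=0$, and $\widetilde Y_i=Y_i(Y_k+1)^{Q_{ik}}$ if $Q_{ik}\ge 0$ and $Q_{ki}=0$. **The quiver $Q(A_r,\ell)$.** Its vertex set is $\mathbf I=\{1,\dots,r\}\times\{1,\dots,\ell-1\}$.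 Fix bipartite decompositions of the path graphs (Dynkin diagrams $A_r$, $A_{\ell-1}$) on $\{1,\dots,r\}$ and $\{1,\dots,\ell-1\}$ into $+$ and $-$ nodes (adjacent nodes have opposite sign), and give $(a,m)$ the product of the signs of $a$ and $m$. Let $\mathbf I_+$, $\mathbf I_-$ be the sets of vertices with sign $+$, $-$. The arrows are: one arrow $(a,m)\to(a,m')$ if $|m-m'|=1$ and $(a,m)\in\mathbf I_+$; one arrow $(a,m)\to(b,m)$ if $|a-b|=1$ and $(a,m)\in\mathbf I_-$; no others. **The mutation loop $\gamma(A_r,\ell)$.** Starting from the $Y$-seed $(Q(A_r,\ell),(y_i)_{i\in\mathbf I})$, mutate once at each vertex of $\mathbf I_+$ (in any order) and then once at each vertex of $\mathbf I_-$ (in any order); the final quiver is again $Q(A_r,\ell)$. The final tuple of rational functions is the cluster transformation $\mu_\gamma(y)=(\mu_i(y))_{i\in\mathbf I}$. It is a fact that $\mu_\gamma(y)=y$ has exactly one solution $\eta\in(\mathbb R_{>0})^{\mathbf I}$. The Jacobian matrix is $J_\gamma(y)=\bigl(\partial\mu_i/\partial y_j(y)\bigr)_{i,j\in\mathbf I}$. **The polynomials $N$ and $D$.** Let $\Delta$ be the root system of type $A_r$ with inner product $(\cdot\,|\,\cdot)$ normalized so that $(\alpha\,|\,\alpha)=2$ for roots, and let $\rho$ be half the sum of the positive roots. The dual Coxeter number is $r+1$. Put $$N_{A_r,\ell}(x)=\left(\frac{x^{\ell+r+1}-1}{x-1}\right)^{r},\qquad D_{A_r,\ell}(x)=\prod_{\alpha\in\Delta}\Bigl(x-e^{2\pi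 i(\rho\,|\,\alpha)/(\ell+r+1)}\Bigr).$$ *)

theory Defs
  imports
    "HOL-Analysis.Derivative"
    "HOL-Library.Poly_Mapping"
    "HOL-Library.Nat_Bijection"
    "HOL-Computational_Algebra.Fraction_Field"
    "HOL-Computational_Algebra.Polynomial_Factorial"
    "Jordan_Normal_Form.Char_Poly"
begin

section \<open>Quivers and their mutation\<close>

text \<open>A quiver is given by its arrow multiplicities: \<open>Q i j\<close> is the number of arrows from
  \<open>i\<close> to \<open>j\<close>.\<close>

type_synonym 'v quiver = "'v \<Rightarrow> 'v \<Rightarrow> nat"

definition is_quiver :: "'v set \<Rightarrow> 'v quiver \<Rightarrow> bool" where
  "is_quiver I Q \<longleftrightarrow> finite I \<and> (\<forall>i j. Q i j \<noteq> 0 \<longrightarrow> i \<in> I \<and> j \<in> I)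
     \<and> (\<forall>i. Q i i = 0) \<and> (\<forall>i j. Q i j = 0 \<or> Q j i = 0)"

definition add_paths :: "'v \<Rightarrow> 'v quiver \<Rightarrow> 'v quiver" where
  "add_paths k Q = (\<lambda>i j. Q i j + Q i k * Q k j)"

definition reverse_at :: "'v \<Rightarrow> 'v quiver \<Rightarrow> 'v quiver" where
  "reverse_at k Q = (\<lambda>i j. if i = k \<or> j = k then Q j i else Q i j)"

text \<open>Truncated subtraction on \<^typ>\<open>nat\<close> is intended: it removes a maximal set of disjoint
  2-cycles.\<close>

definition remove_2cycles :: "'v quiver \<Rightarrow> 'v quiver" where
  "remove_2cycles Q = (\<lambda>i j. Q i j - Q j i)"

definition mutate_quiver :: "'v \<Rightarrow> 'v quiver \<Rightarrow> 'v quiver" where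
  "mutate_quiver k Q = remove_2cycles (reverse_at k (add_paths k Q))"

lemma is_quiver_mutate:
  assumes "is_quiver I Q" "k \<in> I"
  shows "is_quiver I (mutate_quiver k Q)"
proof -
  have fin: "finite I"
    using assms(1) by (simp add: is_quiver_def)
  have Q: "Q i j = 0" if "i \<notin> I \<or> j \<notin> I" for i j
    using assms(1) that unfolding is_quiver_def by metis
  note defs = mutate_quiver_def remove_2cycles_def reverse_at_def add_paths_def
  have "mutate_quiver k Q i j = 0" if "\<not> (i \<in> I \<and> j \<in> I)" for i j
  proof -
    have "add_paths k Q i j = 0" "add_paths k Q j i = 0"
      using that by (auto simp: add_paths_def Q)
    then show ?thesis
      by (auto simp: mutate_quiver_def remove_2cycles_def reverse_at_def)
  qed
  moreover have "mutate_quiver k Q i i = 0" for i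
    by (simp add: defs)
  moreover have "mutate_quiver k Q i j = 0 \<or> mutate_quiver k Q j i = 0" for i j
    by (simp add: mutate_quiver_def remove_2cycles_def) (metis nat_le_linear)
  ultimately show ?thesis
    using fin unfolding is_quiver_def by metis
qed


section \<open>Rational functions\<close>

text \<open>Polynomials over the rationals in variables indexed by \<^typ>\<open>nat\<close>, and their fraction
  field. The variable attached to the vertex \<open>(a, m)\<close> is the one with index
  \<open>prod_encode (a, m)\<close>: indexing directly by pairs would need a linear order on pairs
  to make the polynomial ring an instance of \<^class>\<open>idom\<close>, and that instance clashes with the
  componentwise order used in HOL-Analysis.\<close>

type_synonym mpoly = "(nat \<Rightarrow>\<^sub>0 nat) \<Rightarrow>\<^sub>0 rat"
type_synonym ratfun = "mpoly fract"
type_synonym vertex = "nat \<times> nat"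

definition yvar :: "vertex \<Rightarrow> ratfun" where
  "yvar i = to_fract (Poly_Mapping.single (Poly_Mapping.single (prod_encode i) 1) 1)"

inductive_set subtraction_free :: "vertex set \<Rightarrow> ratfun set" for I where
  var: "i \<in> I \<Longrightarrow> yvar i \<in> subtraction_free I"
| one: "1 \<in> subtraction_free I"
| add: "f \<in> subtraction_free I \<Longrightarrow> g \<in> subtraction_free I \<Longrightarrow> f + g \<in> subtraction_free I"
| mult: "f \<in> subtraction_free I \<Longrightarrow> g \<in> subtraction_free I \<Longrightarrow> f * g \<in> subtraction_free I"
| divide: "f \<in> subtraction_free I \<Longrightarrow> g \<in> subtraction_free I \<Longrightarrow> f / g \<in> subtraction_free I"

definition eval_monom :: "(vertex \<Rightarrow> real) \<Rightarrow> (nat \<Rightarrow>\<^sub>0 nat) \<Rightarrow> real" where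
  "eval_monom y m = (\<Prod>v\<in>Poly_Mapping.keys m. y (prod_decode v) ^ Poly_Mapping.lookup m v)"

definition eval_mpoly :: "(vertex \<Rightarrow> real) \<Rightarrow> mpoly \<Rightarrow> real" where
  "eval_mpoly y p =
     (\<Sum>m\<in>Poly_Mapping.keys p. of_rat (Poly_Mapping.lookup p m) * eval_monom y m)"

text \<open>The value at \<open>y\<close> is computed from any representing fraction whose denominator does not
  vanish at \<open>y\<close>; see \<open>eval_ratfun_Fract\<close> below.\<close>

definition eval_ratfun :: "(vertex \<Rightarrow> real) \<Rightarrow> ratfun \<Rightarrow> real" where
  "eval_ratfun y f = (THE v. \<exists>p q. f = Fraction_Field.Fract p q \<and> eval_mpoly y q \<noteq> 0
     \<and> v = eval_mpoly y p / eval_mpoly y q)"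

lemma eval_monom_superset:
  assumes "finite V" "Poly_Mapping.keys m \<subseteq> V"
  shows "eval_monom y m = (\<Prod>v\<in>V. y (prod_decode v) ^ Poly_Mapping.lookup m v)"
  unfolding eval_monom_def
  by (rule prod.mono_neutral_left) (use assms in \<open>auto simp: in_keys_iff\<close>)

lemma eval_monom_add: "eval_monom y (m + n) = eval_monom y m * eval_monom y n"
proof -
  let ?V = "Poly_Mapping.keys m \<union> Poly_Mapping.keys n"
  have "Poly_Mapping.keys (m + n) \<subseteq> ?V" by (rule Poly_Mapping.keys_add)
  then show ?thesis
    by (simp add: eval_monom_superset[of ?V] lookup_add power_add prod.distrib)
qed

lemma eval_mpoly_superset:
  assumes "finite V" "Poly_Mapping.keys p \<subseteq> V"
  shows "eval_mpoly y p = (\<Sum>m\<in>V. of_rat (Poly_Mapping.lookup p m) * eval_monom y m)"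
  unfolding eval_mpoly_def
  by (rule sum.mono_neutral_left) (use assms in \<open>auto simp: in_keys_iff\<close>)

lemma eval_mpoly_0 [simp]: "eval_mpoly y 0 = 0"
  by (simp add: eval_mpoly_def)

lemma eval_mpoly_single [simp]:
  "eval_mpoly y (Poly_Mapping.single m c) = of_rat c * eval_monom y m"
  by (simp add: eval_mpoly_superset[of "{m}"])

lemma eval_mpoly_1 [simp]: "eval_mpoly y 1 = 1"
  by (simp add: eval_monom_def flip: single_one)

lemma eval_mpoly_add: "eval_mpoly y (p + q) = eval_mpoly y p + eval_mpoly y q"
proof -
  let ?V = "Poly_Mapping.keys p \<union> Poly_Mapping.keys q"
  have "Poly_Mapping.keys (p + q) \<subseteq> ?V" by (rule Poly_Mapping.keys_add)
  then show ?thesis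
    by (simp add: eval_mpoly_superset[of ?V] lookup_add of_rat_add algebra_simps sum.distrib)
qed

lemma eval_mpoly_sum: "eval_mpoly y (sum f A) = (\<Sum>a\<in>A. eval_mpoly y (f a))"
  by (induction A rule: infinite_finite_induct) (simp_all add: eval_mpoly_add)

lemma mpoly_sum_single:
  "(p :: mpoly) = (\<Sum>m\<in>Poly_Mapping.keys p. Poly_Mapping.single m (Poly_Mapping.lookup p m))"
proof (rule poly_mapping_eqI)
  fix k
  show "Poly_Mapping.lookup p k = Poly_Mapping.lookup
     (\<Sum>m\<in>Poly_Mapping.keys p. Poly_Mapping.single m (Poly_Mapping.lookup p m)) k"
    by (simp add: lookup_sum lookup_single when_def in_keys_iff)
qed

lemma eval_mpoly_mult: "eval_mpoly y (p * q) = eval_mpoly y p * eval_mpoly y q"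
proof -
  let ?s = "\<lambda>p m. Poly_Mapping.single m (Poly_Mapping.lookup p m) :: mpoly"
  have "eval_mpoly y (p * q) = eval_mpoly y
      ((\<Sum>m\<in>Poly_Mapping.keys p. ?s p m) * (\<Sum>n\<in>Poly_Mapping.keys q. ?s q n))"
    by (simp only: mpoly_sum_single[symmetric])
  also have "\<dots> = eval_mpoly y
      (\<Sum>m\<in>Poly_Mapping.keys p. ?s p m) * eval_mpoly y (\<Sum>n\<in>Poly_Mapping.keys q. ?s q n)"
    by (simp add: sum_product eval_mpoly_sum mult_single eval_monom_add of_rat_mult mult_ac)
  finally show ?thesis
    by (simp only: mpoly_sum_single[symmetric])
qed

lemma eval_ratfun_Fract:
  assumes "eval_mpoly y q \<noteq> 0"
  shows "eval_ratfun y (Fraction_Field.Fract p q) = eval_mpoly y p / eval_mpoly y q"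
  unfolding eval_ratfun_def
proof (rule the_equality)
  show "\<exists>p' q'. Fraction_Field.Fract p q = Fraction_Field.Fract p' q' \<and> eval_mpoly y q' \<noteq> 0
     \<and> eval_mpoly y p / eval_mpoly y q = eval_mpoly y p' / eval_mpoly y q'"
    using assms by blast
next
  fix v
  assume "\<exists>p' q'. Fraction_Field.Fract p q = Fraction_Field.Fract p' q' \<and> eval_mpoly y q' \<noteq> 0
     \<and> v = eval_mpoly y p' / eval_mpoly y q'"
  then obtain p' q' where pq: "Fraction_Field.Fract p q = Fraction_Field.Fract p' q'"
      "eval_mpoly y q' \<noteq> 0" "v = eval_mpoly y p' / eval_mpoly y q'"
    by blast
  have "q \<noteq> 0" "q' \<noteq> 0" using assms pq(2) by auto
  with pq(1) have "p * q' = p' * q" by (simp add: eq_fract)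
  then have "eval_mpoly y p * eval_mpoly y q' = eval_mpoly y p' * eval_mpoly y q"
    by (metis eval_mpoly_mult)
  then show "v = eval_mpoly y p / eval_mpoly y q"
    unfolding pq(3) using assms pq(2) by (simp add: frac_eq_eq)
qed

lemma subtraction_free_positive_fraction:
  assumes "f \<in> subtraction_free I" "\<And>i. i \<in> I \<Longrightarrow> y i > 0"
  shows "\<exists>p q. f = Fraction_Field.Fract p q \<and> eval_mpoly y p > 0 \<and> eval_mpoly y q > 0"
  using assms(1)
proof induction
  case (var i)
  have "eval_mpoly y (Poly_Mapping.single (Poly_Mapping.single (prod_encode i) 1) 1) = y i"
    by (simp add: eval_monom_def)
  then show ?case unfolding yvar_def to_fract_def
    using assms(2)[OF var]
    by (intro exI[of _ "Poly_Mapping.single (Poly_Mapping.single (prod_encode i) 1) 1"]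
        exI[of _ 1]) simp
next
  case one
  show ?case by (intro exI[of _ 1]) (simp add: One_fract_def)
next
  case (add f g)
  then obtain p q p' q' where *: "f = Fraction_Field.Fract p q" "eval_mpoly y p > 0"
    "eval_mpoly y q > 0" "g = Fraction_Field.Fract p' q'" "eval_mpoly y p' > 0"
    "eval_mpoly y q' > 0" by blast
  then have "q \<noteq> 0" "q' \<noteq> 0" by auto
  then show ?case using *
    by (intro exI[of _ "p * q' + p' * q"] exI[of _ "q * q'"])
      (simp add: eval_mpoly_mult eval_mpoly_add add_pos_pos)
next
  case (mult f g)
  then obtain p q p' q' where *: "f = Fraction_Field.Fract p q" "eval_mpoly y p > 0"
    "eval_mpoly y q > 0" "g = Fraction_Field.Fract p' q'" "eval_mpoly y p' > 0"
    "eval_mpoly y q' > 0" by blast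
  then show ?case
    by (intro exI[of _ "p * p'"] exI[of _ "q * q'"]) (simp add: eval_mpoly_mult)
next
  case (divide f g)
  then obtain p q p' q' where *: "f = Fraction_Field.Fract p q" "eval_mpoly y p > 0"
    "eval_mpoly y q > 0" "g = Fraction_Field.Fract p' q'" "eval_mpoly y p' > 0"
    "eval_mpoly y q' > 0" by blast
  then show ?case
    by (intro exI[of _ "p * q'"] exI[of _ "q * p'"]) (simp add: eval_mpoly_mult)
qed


section \<open>Y-seeds and their mutation\<close>

type_synonym seed = "vertex quiver \<times> (vertex \<Rightarrow> ratfun)"

definition is_Y_seed :: "vertex set \<Rightarrow> seed \<Rightarrow> bool" where
  "is_Y_seed I s \<longleftrightarrow> is_quiver I (fst s) \<and> (\<forall>i\<in>I. snd s i \<in> subtraction_free I)"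

text \<open>At most one of \<open>Q k i\<close> and \<open>Q i k\<close> is nonzero, so the two last cases are exhaustive; if
  both vanish, either formula gives \<open>Y i\<close>.\<close>

definition mutate_Y :: "vertex \<Rightarrow> vertex quiver \<Rightarrow> (vertex \<Rightarrow> ratfun) \<Rightarrow> vertex \<Rightarrow> ratfun" where
  "mutate_Y k Q Y = (\<lambda>i.
     if i = k then inverse (Y k)
     else if Q i k = 0 then Y i * (inverse (Y k) + 1) powi (- int (Q k i))
     else Y i * (Y k + 1) ^ Q i k)"

definition mutate_seed :: "vertex \<Rightarrow> seed \<Rightarrow> seed" where
  "mutate_seed k s = (mutate_quiver k (fst s), mutate_Y k (fst s) (snd s))"

lemma is_Y_seed_mutate:
  assumes "is_Y_seed I s" "k \<in> I"
  shows "is_Y_seed I (mutate_seed k s)"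
proof -
  let ?S = "subtraction_free I"
  have inv: "inverse f \<in> ?S" if "f \<in> ?S" for f
    using subtraction_free.divide[OF subtraction_free.one that] by (simp add: inverse_eq_divide)
  have pow: "f ^ n \<in> ?S" if "f \<in> ?S" for f n
    by (induction n) (auto intro: subtraction_free.intros that)
  have "mutate_Y k (fst s) (snd s) i \<in> ?S" if "i \<in> I" for i
    using assms that unfolding is_Y_seed_def mutate_Y_def
    by (auto simp: power_int_minus intro!: subtraction_free.intros inv pow)
  then show ?thesis
    using assms by (simp add: is_Y_seed_def mutate_seed_def is_quiver_mutate)
qed


section \<open>The quiver of type A and its mutation loop\<close>

text \<open>A bipartite decomposition of the path graph on \<open>{1..n}\<close>, as a sign function.\<close>

definition bipartite_signs :: "nat \<Rightarrow> (nat \<Rightarrow> int) \<Rightarrow> bool" where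
  "bipartite_signs n s \<longleftrightarrow> (\<forall>a\<in>{1..n}. s a = 1 \<or> s a = -1)
     \<and> (\<forall>a\<in>{1..n}. \<forall>b\<in>{1..n}. \<bar>int a - int b\<bar> = 1 \<longrightarrow> s a = - s b)"

definition vertices :: "nat \<Rightarrow> nat \<Rightarrow> vertex set" where
  "vertices r l = {1..r} \<times> {1..l - 1}"

definition signed_vertices ::
  "nat \<Rightarrow> nat \<Rightarrow> (nat \<Rightarrow> int) \<Rightarrow> (nat \<Rightarrow> int) \<Rightarrow> int \<Rightarrow> vertex set" where
  "signed_vertices r l s t e = {(a, m) \<in> vertices r l. s a * t m = e}"

definition quiver_A ::
  "nat \<Rightarrow> nat \<Rightarrow> (nat \<Rightarrow> int) \<Rightarrow> (nat \<Rightarrow> int) \<Rightarrow> vertex quiver" where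
  "quiver_A r l s t = (\<lambda>(a, m) (b, n).
     if (a, m) \<in> vertices r l \<and> (b, n) \<in> vertices r l \<and>
        (a = b \<and> \<bar>int m - int n\<bar> = 1 \<and> (a, m) \<in> signed_vertices r l s t 1 \<or>
         m = n \<and> \<bar>int a - int b\<bar> = 1 \<and> (a, m) \<in> signed_vertices r l s t (-1))
     then 1 else 0)"

lemma quiver_A_nonzero_iff:
  "quiver_A r l s t (a, m) (b, n) \<noteq> 0 \<longleftrightarrow>
     (a, m) \<in> vertices r l \<and> (b, n) \<in> vertices r l \<and>
       (a = b \<and> \<bar>int m - int n\<bar> = 1 \<and> s a * t m = 1 \<or>
        m = n \<and> \<bar>int a - int b\<bar> = 1 \<and> s a * t m = -1)"
  by (simp add: quiver_A_def signed_vertices_def) blast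

lemma is_quiver_quiver_A:
  assumes "bipartite_signs r s" "bipartite_signs (l - 1) t"
  shows "is_quiver (vertices r l) (quiver_A r l s t)"
proof -
  have s: "s a = - s b" if "a \<in> {1..r}" "b \<in> {1..r}" "\<bar>int a - int b\<bar> = 1" for a b
    using assms(1) that unfolding bipartite_signs_def by blast
  have t: "t a = - t b" if "a \<in> {1..l-1}" "b \<in> {1..l-1}" "\<bar>int a - int b\<bar> = 1" for a b
    using assms(2) that unfolding bipartite_signs_def by blast
  have "quiver_A r l s t i j = 0 \<or> quiver_A r l s t j i = 0" for i j
  proof (rule ccontr)
    assume "\<not> ?thesis"
    then have ne: "quiver_A r l s t i j \<noteq> 0" "quiver_A r l s t j i \<noteq> 0" by simp_all
    obtain a m b n where ij: "i = (a, m)" "j = (b, n)" by (cases i, cases j)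
    note 1 = ne(1)[unfolded ij quiver_A_nonzero_iff]
    note 2 = ne(2)[unfolded ij quiver_A_nonzero_iff]
    have v: "a \<in> {1..r}" "b \<in> {1..r}" "m \<in> {1..l-1}" "n \<in> {1..l-1}"
      using 1 unfolding vertices_def by blast+
    show False
    proof (cases "a = b")
      case True
      then have "\<bar>int m - int n\<bar> = 1" "s a * t m = 1" "s a * t n = 1"
        using 1 2 by auto
      moreover from this(1) have "t m = - t n" by (rule t[OF v(3,4)])
      ultimately show False by simp
    next
      case False
      then have "m = n" using 1 by blast
      with False have "\<bar>int a - int b\<bar> = 1" "s a * t m = -1" "s b * t m = -1"
        using 1 2 by auto
      moreover from this(1) have "s a = - s b" by (rule s[OF v(1,2)])
      ultimately show False by simp
    qed
  qed
  moreover have "finite (vertices r l)" by (simp add: vertices_def)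
  moreover have "quiver_A r l s t i i = 0" for i
    by (cases i) (simp add: quiver_A_def)
  moreover have "i \<in> vertices r l \<and> j \<in> vertices r l" if "quiver_A r l s t i j \<noteq> 0" for i j
    using that by (metis quiver_A_nonzero_iff surj_pair)
  ultimately show ?thesis unfolding is_quiver_def by (intro conjI allI impI) simp_all
qed

definition loop_orders ::
  "nat \<Rightarrow> nat \<Rightarrow> (nat \<Rightarrow> int) \<Rightarrow> (nat \<Rightarrow> int) \<Rightarrow> vertex list set" where
  "loop_orders r l s t = {ps @ ms | ps ms.
     distinct ps \<and> set ps = signed_vertices r l s t 1 \<and>
     distinct ms \<and> set ms = signed_vertices r l s t (-1)}"

definition cluster_transformation ::
  "nat \<Rightarrow> nat \<Rightarrow> (nat \<Rightarrow> int) \<Rightarrow> (nat \<Rightarrow> int) \<Rightarrow> vertex list \<Rightarrow> vertex \<Rightarrow> ratfun" where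
  "cluster_transformation r l s t ks = snd (fold mutate_seed ks (quiver_A r l s t, yvar))"

text \<open>An enumeration of \<^term>\<open>vertices r l\<close> by \<open>{..<r * (l - 1)}\<close>, to index matrices.\<close>

definition vertex_of :: "nat \<Rightarrow> nat \<Rightarrow> vertex" where
  "vertex_of l p = (p div (l - 1) + 1, p mod (l - 1) + 1)"

lemma bij_betw_vertex_of: "bij_betw (vertex_of l) {..<r * (l - 1)} (vertices r l)"
proof -
  define d where "d = l - 1"
  have vertex_of: "vertex_of l p = (p div d + 1, p mod d + 1)" for p
    by (simp add: vertex_of_def d_def)
  have vertices: "vertices r l = {1..r} \<times> {1..d}"
    by (simp add: vertices_def d_def)
  have "bij_betw (vertex_of l) {..<r * d} (vertices r l)"
  proof (rule bij_betw_byWitness[where f' = "\<lambda>(a, m). (a - 1) * d + (m - 1)"])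
    show "\<forall>p\<in>{..<r * d}. (case vertex_of l p of (a, m) \<Rightarrow> (a - 1) * d + (m - 1)) = p"
      by (simp add: vertex_of)
    have "vertex_of l ((a - 1) * d + (m - 1)) = (a, m)"
      if "1 \<le> a" "1 \<le> m" "m \<le> d" for a m
    proof -
      have "a = Suc (a - 1)" "m = Suc (m - 1)"
        using that by simp_all
      then obtain a' m' where "a = Suc a'" "m = Suc m'" by blast
      with that(3) show ?thesis by (simp add: vertex_of)
    qed
    then show "\<forall>v\<in>vertices r l. vertex_of l (case v of (a, m) \<Rightarrow> (a - 1) * d + (m - 1)) = v"
      by (auto simp: vertices)
    have "p div d < r" "p mod d < d" if "p < r * d" for p
      using that by (cases "d = 0"; simp add: less_mult_imp_div_less)+
    then show "vertex_of l ` {..<r * d} \<subseteq> vertices r l"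
      by (auto simp: vertices vertex_of Suc_le_eq)
    have "(a - 1) * d + (m - 1) < r * d" if "1 \<le> a" "a \<le> r" "1 \<le> m" "m \<le> d" for a m
    proof -
      have "(a - 1) * d + (m - 1) < (a - 1) * d + d" using that by simp
      also have "\<dots> = a * d" using that(1) by (cases a) simp_all
      also have "\<dots> \<le> r * d" using that(2) by simp
      finally show ?thesis .
    qed
    then show "(\<lambda>(a, m). (a - 1) * d + (m - 1)) ` vertices r l \<subseteq> {..<r * d}"
      by (auto simp: vertices)
  qed
  then show ?thesis by (simp add: d_def)
qed

definition jacobian :: "nat \<Rightarrow> nat \<Rightarrow> (vertex \<Rightarrow> ratfun) \<Rightarrow> (vertex \<Rightarrow> real) \<Rightarrow> real mat" where
  "jacobian r l f y = mat (r * (l - 1)) (r * (l - 1)) (\<lambda>(p, q).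
     deriv (\<lambda>x. eval_ratfun (y(vertex_of l q := x)) (f (vertex_of l p))) (y (vertex_of l q)))"


section \<open>Root system of type A and the polynomials N and D\<close>

text \<open>The roots are \<open>e\<^sub>i - e\<^sub>j\<close> in the Euclidean space of dimension \<open>r + 1\<close>, so the standard
  inner product \<^const>\<open>scalar_prod\<close> has the required normalization; \<open>e\<^sub>i - e\<^sub>j\<close> is positive
  iff \<open>i < j\<close>.\<close>

definition roots_A :: "nat \<Rightarrow> real vec set" where
  "roots_A r = {unit_vec (r + 1) i - unit_vec (r + 1) j | i j. i < r + 1 \<and> j < r + 1 \<and> i \<noteq> j}"

definition positive_roots_A :: "nat \<Rightarrow> real vec set" where
  "positive_roots_A r = {unit_vec (r + 1) i - unit_vec (r + 1) j | i j. i < j \<and> j < r + 1}"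

definition rho_A :: "nat \<Rightarrow> real vec" where
  "rho_A r = vec (r + 1) (\<lambda>k. (\<Sum>\<alpha>\<in>positive_roots_A r. vec_index \<alpha> k) / 2)"

text \<open>The division is exact, see \<open>N_poly_exact\<close>.\<close>

definition N_poly :: "nat \<Rightarrow> nat \<Rightarrow> complex poly" where
  "N_poly r l = ((monom 1 (l + r + 1) - 1) div (monom 1 1 - 1)) ^ r"

lemma N_poly_exact: "N_poly r l * (monom 1 1 - 1) ^ r = (monom 1 (l + r + 1) - 1) ^ r"
proof -
  have "(monom 1 1 - 1 :: complex poly) dvd monom 1 1 ^ (l + r + 1) - 1 ^ (l + r + 1)"
    unfolding power_diff_sumr2 by (rule dvd_triv_left)
  then have "(monom 1 1 - 1 :: complex poly) dvd monom 1 (l + r + 1) - 1"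
    unfolding monom_power power_one mult_1 .
  then have "(monom 1 (l + r + 1) - 1) div (monom 1 1 - 1) * (monom 1 1 - 1)
      = (monom 1 (l + r + 1) - 1 :: complex poly)"
    by (rule dvd_div_mult_self)
  then show ?thesis
    unfolding N_poly_def power_mult_distrib[symmetric] by (rule arg_cong)
qed

definition D_poly :: "nat \<Rightarrow> nat \<Rightarrow> complex poly" where
  "D_poly r l = (\<Prod>\<alpha>\<in>roots_A r.
     [:- exp (2 * of_real pi * \<i> * of_real (scalar_prod (rho_A r) \<alpha>) / of_nat (l + r + 1)), 1:])"

end

theory Submission
  imports Defs
begin

text \<open>In both cases the quiver is an alternating path with \<open>n\<close> vertices, and \<open>\<mu>\<^sub>\<gamma>\<close> is a composite of two
  mutations at sets of pairwise disconnected sources (\<open>r = 1\<close>) or sinks (\<open>l = 2\<close>). After inverting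
  some coordinates, the fixed point equation is the constant Y-system
  \<open>v\<^sub>i\<^sup>2 = (1 + v\<^bsub>i-1\<^esub>) (1 + v\<^bsub>i+1\<^esub>)\<close>. With \<open>1 + v\<^sub>i = q\<^sub>i\<^sup>2\<close> it becomes the frieze relation
  \<open>q\<^sub>i\<^sup>2 = 1 + q\<^bsub>i-1\<^esub> q\<^bsub>i+1\<^esub>\<close>, which forces \<open>q\<^sub>i = sin ((i + 1) \<theta>) / sin \<theta>\<close> with \<open>\<theta> = \<pi> / (n + 3)\<close>.
  In logarithmic coordinates an eigenvector of the Jacobian for the eigenvalue \<open>e\<^bsup>2i\<psi>\<^esup>\<close> amounts
  to a solution \<open>w\<close> of the tridiagonal system
  \<open>p\<^bsub>i-1\<^esub> w\<^bsub>i-1\<^esub> + p\<^bsub>i+1\<^esub> w\<^bsub>i+1\<^esub> = 2 cos \<psi> w\<^sub>i\<close>, where \<open>p\<^sub>i = v\<^sub>i / (1 + v\<^sub>i)\<close>. Such a \<open>w\<close> is explicit for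
  \<open>\<psi> = m \<theta>\<close>, \<open>2 \<le> m \<le> n + 1\<close>, and these \<open>n\<close> distinct eigenvalues are exactly the roots left over
  when \<open>D\<close> is cancelled from \<open>N\<close>.\<close>

section \<open>The constant Y-system of a path\<close>

lemma sin_three_term:
  fixes x :: real
  shows "sin (real (Suc (Suc k)) * x) = 2 * cos x * sin (real (Suc k) * x) - sin (real k * x)"
proof -
  have 1: "real (Suc (Suc k)) * x = real (Suc k) * x + x" "real k * x = real (Suc k) * x - x"
    by (simp_all add: algebra_simps)
  show ?thesis unfolding 1 by (simp only: sin_add sin_diff) (simp add: algebra_simps)
qed

text \<open>The ratio of \<open>q i + q (i + 2)\<close> to \<open>q (i + 1)\<close> does not depend
  on \<open>i\<close>: subtracting two consecutive frieze relations shows this, and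
  \<open>q 0 = 1\<close> identifies the constant as \<open>q 1\<close>.\<close>

lemma frieze_linear:
  fixes q :: "nat \<Rightarrow> real"
  assumes "\<And>i. i \<le> Suc n \<Longrightarrow> q i > 0" "q 0 = 1"
    and "\<And>i. i < n \<Longrightarrow> q (Suc i) ^ 2 = 1 + q i * q (Suc (Suc i))"
  shows "i < n \<Longrightarrow> q (Suc (Suc i)) = q 1 * q (Suc i) - q i"
proof (induction i)
  case 0
  then show ?case using assms(3)[of 0] assms(2) by (simp add: power2_eq_square)
next
  case (Suc i)
  have pos: "q (Suc i) > 0" by (rule assms(1)) (use Suc.prems in simp)
  have IH: "q (Suc (Suc i)) = q 1 * q (Suc i) - q i" using Suc by simp
  have e: "q (Suc (Suc i)) ^ 2 = 1 + q (Suc i) * q (Suc (Suc (Suc i)))"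
    "q (Suc i) ^ 2 = 1 + q i * q (Suc (Suc i))"
    using assms(3) Suc.prems by simp_all
  have "q (Suc i) * q (Suc (Suc (Suc i))) = q (Suc (Suc i)) * q (Suc (Suc i)) - 1"
    using e(1) by (simp add: power2_eq_square)
  also have "\<dots> = q (Suc (Suc i)) * (q 1 * q (Suc i) - q i) - 1" using IH by simp
  also have "\<dots> = q (Suc i) * (q 1 * q (Suc (Suc i)) - q (Suc i))"
    using e(2) by (simp add: power2_eq_square algebra_simps)
  finally show ?case using pos by simp
qed

text \<open>By \<open>frieze_linear\<close> the sequence is determined by the single number
  \<open>q 1 = 2 cos \<phi>\<close>, so it is a Chebyshev sequence. Positivity together with the
  right boundary value then leaves only \<phi> = \<theta>.\<close>

lemma frieze_solution:
  fixes q :: "nat \<Rightarrow> real"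
  assumes pos: "\<And>i. i \<le> Suc n \<Longrightarrow> q i > 0" and q0: "q 0 = 1" and qn: "q (Suc n) = 1"
    and gt1: "q 1 > 1" "q n > 1"
    and rec: "\<And>i. i < n \<Longrightarrow> q (Suc i) ^ 2 = 1 + q i * q (Suc (Suc i))"
  defines "\<theta> \<equiv> pi / real (n + 3)"
  shows "i \<le> Suc n \<Longrightarrow> q i * sin \<theta> = sin (real (Suc i) * \<theta>)"
proof -
  have n: "n > 0" using gt1 qn by (cases n) auto
  note lin = frieze_linear[of n q, OF pos q0 rec]
  define c where "c = q 1"
  \<comment> \<open>For c \<ge> 2 the increments of \<open>q\<close> would start at c - 1 \<ge> 1
    and never shrink, against \<open>q (Suc n) = 1 < q n\<close>.\<close>
  have "c < 2"
  proof (rule ccontr)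
    assume c: "\<not> c < 2"
    have "q (Suc i) \<ge> q i + 1" if "i \<le> n" for i
      using that
    proof (induction i)
      case 0
      then show ?case using c q0 by (simp add: c_def)
    next
      case (Suc i)
      have "q (Suc (Suc i)) = c * q (Suc i) - q i"
        using lin[of i] Suc.prems by (simp add: c_def)
      moreover have "c * q (Suc i) \<ge> 2 * q (Suc i)"
        using c pos[of "Suc i"] Suc.prems by simp
      ultimately show ?case using Suc by simp
    qed
    from this[of n] show False using gt1 qn by simp
  qed
  define \<phi> where "\<phi> = arccos (c / 2)"
  have c: "0 < c" "c < 2" using gt1 \<open>c < 2\<close> by (simp_all add: c_def)
  have cos: "2 * cos \<phi> = c" using c by (simp add: \<phi>_def)
  have "\<phi> < arccos 0" unfolding \<phi>_def using c by (intro arccos_less_arccos) auto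
  then have \<phi>2: "\<phi> < pi / 2" by simp
  have \<phi>0: "\<phi> > 0" using arccos_lt_bounded[of "c / 2"] c by (simp add: \<phi>_def)
  have s: "sin \<phi> > 0" using \<phi>0 \<phi>2 by (intro sin_gt_zero) auto
  have q: "q i * sin \<phi> = sin (real (Suc i) * \<phi>) \<and> q (Suc i) * sin \<phi> = sin (real (Suc (Suc i)) * \<phi>)"
    if "i \<le> n" for i
    using that
  proof (induction i)
    case 0
    then show ?case using q0 cos sin_three_term[of 0 \<phi>] by (simp add: c_def)
  next
    case (Suc i)
    then have "q (Suc (Suc i)) * sin \<phi> = c * (q (Suc i) * sin \<phi>) - q i * sin \<phi>"
      using lin[of i] by (simp add: c_def left_diff_distrib)
    also have "\<dots> = sin (real (Suc (Suc (Suc i))) * \<phi>)"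
      using Suc sin_three_term[of "Suc i" \<phi>] cos by (simp del: of_nat_Suc)
    finally show ?case using Suc by simp
  qed
  have q': "q i * sin \<phi> = sin (real (Suc i) * \<phi>)" if "i \<le> Suc n" for i
    using q[of n] q[of i] that by (cases "i = Suc n") auto
  \<comment> \<open>The angle grows in steps below pi / 2, so it cannot jump over the interval from
    pi to 2 pi, where the sine is not positive.\<close>
  have lt: "real (Suc i) * \<phi> < pi" if "i \<le> Suc n" for i
    using that
  proof (induction i)
    case 0
    have "\<phi> < pi" using \<phi>2 pi_gt_zero by linarith
    then show ?case by simp
  next
    case (Suc i)
    show ?case
    proof (rule ccontr)
      assume "\<not> ?case"
      moreover have "real (Suc (Suc i)) * \<phi> < 2 * pi"
      proof -
        have "real (Suc (Suc i)) * \<phi> = real (Suc i) * \<phi> + \<phi>" by (simp add: algebra_simps)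
        then show ?thesis using Suc \<phi>2 pi_gt_zero by linarith
      qed
      ultimately have "sin (real (Suc (Suc i)) * \<phi>) \<le> 0" by (intro sin_le_zero) auto
      moreover have "q (Suc i) * sin \<phi> > 0" using pos[of "Suc i"] Suc.prems s by simp
      ultimately show False using q'[of "Suc i"] Suc.prems by simp
    qed
  qed
  obtain m where m: "n = Suc m" using n by (cases n) auto
  \<comment> \<open>The last frieze relation and the last linear relation are compared, with
    \<open>q (Suc n) = 1\<close> in both.\<close>
  have "q n * q n = q n * c"
    using lin[of m] rec[of m] qn by (simp add: m power2_eq_square c_def algebra_simps)
  then have "q n = c" using gt1 by simp
  \<comment> \<open>Continuing the linear recurrence one index past the boundary gives
    \<open>c - q n = 0\<close>, which quantizes \<phi>.\<close>
  have "sin (real (n + 3) * \<phi>) = c * (q (Suc n) * sin \<phi>) - q n * sin \<phi>"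
  proof -
    have "n + 3 = Suc (Suc (Suc n))" by simp
    then show ?thesis
      using sin_three_term[of "Suc n" \<phi>] q'[of n] q'[of "Suc n"] cos by (simp only: mult.assoc)
  qed
  then have z: "sin (real (n + 3) * \<phi>) = 0" using qn \<open>q n = c\<close> by simp
  have lt2: "real (n + 3) * \<phi> < 2 * pi"
  proof -
    have "real (n + 3) * \<phi> = real (Suc (Suc n)) * \<phi> + \<phi>" by (simp add: algebra_simps)
    then show ?thesis using lt[of "Suc n"] \<phi>2 pi_gt_zero by linarith
  qed
  have "real (n + 3) * \<phi> = pi"
  proof (rule ccontr)
    assume "real (n + 3) * \<phi> \<noteq> pi"
    then consider "real (n + 3) * \<phi> < pi" | "pi < real (n + 3) * \<phi>" by linarith
    then show False
    proof cases
      case 1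
      then have "sin (real (n + 3) * \<phi>) > 0" using \<phi>0 by (intro sin_gt_zero) auto
      then show False using z by simp
    next
      case 2
      then have "sin (real (n + 3) * \<phi>) < 0" using lt2 by (intro sin_lt_zero) auto
      then show False using z by simp
    qed
  qed
  then have "\<phi> = \<theta>" by (simp add: \<theta>_def field_simps)
  then show "i \<le> Suc n \<Longrightarrow> q i * sin \<theta> = sin (real (Suc i) * \<theta>)" using q'[of i] by simp
qed

text \<open>Put \<open>q i = sqrt (1 + v i)\<close>. As \<open>v\<close> is positive inside, the
  square root of the Y-system reads \<open>v i = q (i - 1) * q (i + 1)\<close>, which is the frieze
  relation. The boundary values 0 of \<open>v\<close> become the values 1 of
  \<open>q\<close>.\<close>

lemma constant_Y_system_solution:
  fixes v :: "nat \<Rightarrow> real"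
  assumes pos: "\<And>i. 1 \<le> i \<Longrightarrow> i \<le> n \<Longrightarrow> v i > 0" and bdry: "v 0 = 0" "v (Suc n) = 0"
    and eq: "\<And>i. i < n \<Longrightarrow> v (Suc i) ^ 2 = (1 + v i) * (1 + v (Suc (Suc i)))"
  defines "\<theta> \<equiv> pi / real (n + 3)"
  assumes i: "i < n"
  shows "v (Suc i) / (1 + v (Suc i)) =
    sin (real (Suc i) * \<theta>) * sin (real (i + 3) * \<theta>) / sin (real (i + 2) * \<theta>) ^ 2"
proof -
  define q where "q i = sqrt (1 + v i)" for i
  have ge0: "v i \<ge> 0" if "i \<le> Suc n" for i
    using pos[of i] bdry that by (cases "i = 0 \<or> i = Suc n") (auto intro: less_imp_le)
  have qpos: "q i > 0" if "i \<le> Suc n" for i using ge0[OF that] by (simp add: q_def)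
  have q2: "q i ^ 2 = 1 + v i" if "i \<le> Suc n" for i using ge0[OF that] by (simp add: q_def)
  have v: "v (Suc i) = q i * q (Suc (Suc i))" if "i < n" for i
    unfolding q_def real_sqrt_mult[symmetric] eq[OF that, symmetric]
    using pos[of "Suc i"] that by simp
  have sol: "q i * sin \<theta> = sin (real (Suc i) * \<theta>)" if "i \<le> Suc n" for i
    unfolding \<theta>_def
  proof (rule frieze_solution[OF qpos])
    show "q (Suc i) ^ 2 = 1 + q i * q (Suc (Suc i))" if "i < n" for i
      using v[OF that] q2[of "Suc i"] that by simp
    show "q 1 > 1" "q n > 1" using pos[of 1] pos[of n] i by (simp_all add: q_def)
  qed (use that bdry in \<open>simp_all add: q_def\<close>)
  have "\<theta> > 0" "\<theta> < pi" by (simp_all add: \<theta>_def divide_less_eq)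
  then have s: "sin \<theta> > 0" by (rule sin_gt_zero)
  have "v (Suc i) / (1 + v (Suc i)) = q i * q (Suc (Suc i)) / q (Suc i) ^ 2"
    using v[OF i] q2[of "Suc i"] i by simp
  also have "\<dots> = (q i * sin \<theta>) * (q (Suc (Suc i)) * sin \<theta>) / (q (Suc i) * sin \<theta>) ^ 2"
    using s by (simp add: power2_eq_square)
  finally show ?thesis using sol[of i] sol[of "Suc i"] sol[of "Suc (Suc i)"] i
    by (simp add: numeral_2_eq_2 numeral_3_eq_3)
qed

section \<open>Eigenmodes of the linearized system\<close>

text \<open>\<open>v\<^sub>i\<close> is a cross ratio of the points \<open>a\<close>, \<open>a + 1\<close>, \<open>a + i + 1\<close>, \<open>a + i + 2\<close> of a regular
  \<open>(n + 3)\<close>-gon on the projective line. Displacing each point \<open>k\<close> infinitesimally by \<open>z\<^sup>k\<close>, where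
  \<open>z\<close> is the root of unity of argument \<open>2\<psi>\<close>, changes \<open>log v\<^sub>i\<close> by a multiple of \<open>path_mode \<theta> \<psi> i\<close>;
  the multiple depends on \<open>i\<close> only through a phase.\<close>

definition path_mode :: "real \<Rightarrow> real \<Rightarrow> nat \<Rightarrow> real" where
  "path_mode \<theta> \<psi> i = sin (real (i + 1) * \<theta>) *
     (sin (real i * \<psi>) / sin (real i * \<theta>) - sin (real (i + 2) * \<psi>) / sin (real (i + 2) * \<theta>))"

text \<open>The numbers \<open>v i / (1 + v i)\<close> of the constant solution, with nodes counted
  from 1.\<close>

definition path_weight :: "real \<Rightarrow> nat \<Rightarrow> real" where
  "path_weight \<theta> i = sin (real i * \<theta>) * sin (real (i + 2) * \<theta>) / sin (real (i + 1) * \<theta>) ^ 2"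

text \<open>The weight cancels both denominators of the mode and leaves only
  \<open>sin ((i + 1) \<theta>)\<close>. The terms of the two neighbours of a node thus get the
  denominators that occur in the mode of the node itself.\<close>

lemma path_weight_mode:
  assumes "\<And>i. 1 \<le> i \<Longrightarrow> i \<le> n + 2 \<Longrightarrow> sin (real i * \<theta>) \<noteq> 0" "1 \<le> i" "i \<le> n"
  shows "path_weight \<theta> i * path_mode \<theta> \<psi> i =
    (sin (real i * \<psi>) * sin (real (i + 2) * \<theta>) - sin (real (i + 2) * \<psi>) * sin (real i * \<theta>))
      / sin (real (i + 1) * \<theta>)"
proof -
  have "sin (real i * \<theta>) \<noteq> 0" "sin (real (i + 1) * \<theta>) \<noteq> 0" "sin (real (i + 2) * \<theta>) \<noteq> 0"
    by (rule assms(1); use assms(2,3) in simp)+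
  then show ?thesis unfolding path_weight_def path_mode_def power2_eq_square
    by (simp add: field_simps del: of_nat_add)
qed

text \<open>The numerators in \<open>path_weight_mode\<close> vanish at the virtual nodes 0 and
  \<open>n + 1\<close>, so the end nodes obey the same formula as the inner ones. The rest follows
  from the three-term recurrence for both sine sequences.\<close>

lemma path_mode_eigen:
  assumes s: "\<And>i. 1 \<le> i \<Longrightarrow> i \<le> n + 2 \<Longrightarrow> sin (real i * \<theta>) \<noteq> 0"
    and \<theta>: "sin (real (n + 3) * \<theta>) = 0" and \<psi>: "sin (real (n + 3) * \<psi>) = 0"
    and k: "k < n"
  shows "(if k > 0 then path_weight \<theta> k * path_mode \<theta> \<psi> k else 0) +
    (if Suc k < n then path_weight \<theta> (k + 2) * path_mode \<theta> \<psi> (k + 2) else 0)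
    = 2 * cos \<psi> * path_mode \<theta> \<psi> (k + 1)"
proof -
  define a where "a i = sin (real i * \<theta>)" for i
  define b where "b i = sin (real i * \<psi>)" for i
  have ne: "a (k + 1) \<noteq> 0" "a (k + 2) \<noteq> 0" "a (k + 3) \<noteq> 0"
    unfolding a_def by (rule s; use k in simp)+
  have left: "(if k > 0 then path_weight \<theta> k * path_mode \<theta> \<psi> k else 0)
      = (b k * a (k + 2) - b (k + 2) * a k) / a (k + 1)"
    using path_weight_mode[of n \<theta> k \<psi>, OF s] k by (auto simp: a_def b_def)
  have right: "(if Suc k < n then path_weight \<theta> (k + 2) * path_mode \<theta> \<psi> (k + 2) else 0)
      = (b (k + 2) * a (k + 4) - b (k + 4) * a (k + 2)) / a (k + 3)"
  proof (cases "Suc k < n")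
    case True
    then show ?thesis
      using path_weight_mode[of n \<theta> "k + 2" \<psi>, OF s]
      by (simp add: a_def b_def add.commute add.left_commute)
  next
    \<comment> \<open>Here \<open>k + 2\<close> is the virtual node \<open>n + 1\<close>; both sines
      at \<open>n + 3\<close> vanish.\<close>
    case False
    then have "n = k + 1" using k by simp
    then have "a (k + 4) = 0" "b (k + 4) = 0" using \<theta> \<psi> by (simp_all add: a_def b_def add.commute)
    then show ?thesis using False by simp
  qed
  have ra: "a (k + 2) = 2 * cos \<theta> * a (k + 1) - a k" "a (k + 3) = 2 * cos \<theta> * a (k + 2) - a (k + 1)"
    "a (k + 4) = 2 * cos \<theta> * a (k + 3) - a (k + 2)"
    using sin_three_term[of k \<theta>] sin_three_term[of "k+1" \<theta>] sin_three_term[of "k+2" \<theta>]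
    by (simp_all add: a_def eval_nat_numeral)
  have rb: "b (k + 2) = 2 * cos \<psi> * b (k + 1) - b k" "b (k + 3) = 2 * cos \<psi> * b (k + 2) - b (k + 1)"
    "b (k + 4) = 2 * cos \<psi> * b (k + 3) - b (k + 2)"
    using sin_three_term[of k \<psi>] sin_three_term[of "k+1" \<psi>] sin_three_term[of "k+2" \<psi>]
    by (simp_all add: b_def eval_nat_numeral)
  have bk: "b k = 2 * cos \<psi> * b (k + 1) - b (k + 2)" "a k = 2 * cos \<theta> * a (k + 1) - a (k + 2)"
    using ra rb by simp_all
  have mode: "path_mode \<theta> \<psi> (k + 1) = a (k + 2) * (b (k + 1) / a (k + 1) - b (k + 3) / a (k + 3))"
    by (simp add: path_mode_def a_def b_def eval_nat_numeral)
  \<comment> \<open>Once the outermost indices are eliminated, the left and right terms contain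
    \<open>2 cos \<theta> * b (k + 2)\<close> with opposite signs, so \<theta> enters the sum only
    through \<open>a\<close>.\<close>
  have "(b k * a (k + 2) - b (k + 2) * a k) / a (k + 1)
     = 2 * cos \<psi> * b (k + 1) * a (k + 2) / a (k + 1) - 2 * cos \<theta> * b (k + 2)"
    unfolding bk using ne by (simp add: field_simps)
  moreover have "(b (k + 2) * a (k + 4) - b (k + 4) * a (k + 2)) / a (k + 3)
     = 2 * cos \<theta> * b (k + 2) - 2 * cos \<psi> * b (k + 3) * a (k + 2) / a (k + 3)"
    unfolding ra(3) rb(3) using ne by (simp add: field_simps)
  ultimately show ?thesis unfolding left right mode by (simp add: algebra_simps)
qed

section \<open>Characteristic polynomials and roots of unity\<close>

text \<open>The difference of the two monic polynomials has degree below \<open>card S\<close> but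
  vanishes on \<open>S\<close>.\<close>

lemma monic_eq_prod_roots:
  fixes p :: "'a :: idom poly"
  assumes S: "finite S" "degree p = card S" and monic: "lead_coeff p = 1"
    and root: "\<And>a. a \<in> S \<Longrightarrow> poly p a = 0"
  shows "p = (\<Prod>a\<in>S. [:- a, 1:])"
proof (rule ccontr)
  let ?P = "\<Prod>a\<in>S. [:- a, 1:]"
  let ?d = "p - ?P"
  assume "p \<noteq> ?P"
  then have d0: "?d \<noteq> 0" by simp
  have dP: "degree ?P = card S" by (simp add: degree_prod_sum_eq)
  moreover have "lead_coeff ?P = 1" by (rule monic_prod) simp
  ultimately have "coeff ?d (card S) = 0" using S monic by simp
  moreover have "degree ?d \<le> card S" using dP S degree_diff_le by (metis order_refl)
  ultimately have lt: "degree ?d < card S"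
    using d0 by (metis leading_coeff_0_iff le_neq_implies_less)
  have "S \<subseteq> {x. poly ?d x = 0}"
    using root S by (auto simp: poly_prod)
  then have "card S \<le> card {x. poly ?d x = 0}"
    by (intro card_mono poly_roots_finite d0)
  also have "\<dots> \<le> degree ?d" by (rule card_poly_roots_bound[OF d0])
  finally show False using lt by simp
qed

text \<open>This reduces the characteristic polynomial to exhibiting \<open>n\<close> distinct
  eigenvalues; no determinant has to be expanded.\<close>

lemma char_poly_distinct_eigenvalues:
  fixes M :: "'a :: field mat"
  assumes M: "M \<in> carrier_mat n n" and S: "finite S" "card S = n"
    and ev: "\<And>a. a \<in> S \<Longrightarrow> eigenvalue M a"
  shows "char_poly M = (\<Prod>a\<in>S. [:- a, 1:])"
  using degree_monic_char_poly[OF M] S ev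
  by (intro monic_eq_prod_roots) (auto simp: eigenvalue_root_char_poly[OF M])

section \<open>Factors of N and D at roots of unity\<close>

definition zeta_factor :: "nat \<Rightarrow> int \<Rightarrow> complex poly" where
  "zeta_factor N k = [:- cis (2 * pi * of_int k / of_nat N), 1:]"

text \<open>The index is an integer that matters only modulo \<open>N\<close>; negative indices come
  from the negative roots or the positive ones, depending on the sign convention for the height, and
  are moved into the range below \<open>N\<close> with this rule.\<close>

lemma zeta_factor_mod: "zeta_factor N (k + int N) = zeta_factor N k"
proof (cases "N = 0")
  case False
  have "2 * pi * of_int (k + int N) / of_nat N = 2 * pi * of_int k / of_nat N + 2 * pi"
    using False by (simp add: field_simps)
  then show ?thesis unfolding zeta_factor_def by (simp add: cis_mult[symmetric])
qed (simp add: zeta_factor_def)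

lemma zeta_factor_nonzero [simp]: "zeta_factor N k \<noteq> 0"
  by (simp add: zeta_factor_def)

lemma zeta_factor_0: "zeta_factor N 0 = monom 1 1 - 1"
  by (simp add: zeta_factor_def monom_altdef one_pCons)

lemma prod_all_zeta_factors:
  assumes "N > 0"
  shows "(\<Prod>k<N. zeta_factor N (int k)) = monom 1 N - 1"
proof -
  have bij: "bij_betw (\<lambda>k. cis (2 * pi * real k / real N)) {..<N} {z. z ^ N = 1}"
    by (rule bij_betw_roots_unity[OF assms])
  have "(\<Prod>k<N. zeta_factor N (int k)) = (\<Prod>z\<in>{z::complex. z ^ N = 1}. [:- z, 1:])"
    using prod.reindex_bij_betw[OF bij, of "\<lambda>z. [:- z, 1:]"]
    by (simp add: zeta_factor_def)
  also have "\<dots> = monom 1 N - 1"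
  proof (rule monic_eq_prod_roots[symmetric])
    show "finite {z::complex. z ^ N = 1}" using assms by (simp add: finite_roots_unity)
    have "degree (- 1 + monom 1 N :: complex poly) = degree (monom 1 N :: complex poly)"
      using assms by (intro degree_add_eq_right) (simp add: degree_monom_eq)
    then have "degree (monom 1 N - 1 :: complex poly) = N" by (simp add: degree_monom_eq)
    then show "degree (monom 1 N - 1 :: complex poly) = card {z::complex. z ^ N = 1}"
      using card_roots_unity_eq[OF assms] by simp
    then show "lead_coeff (monom 1 N - 1 :: complex poly) = 1"
      using assms card_roots_unity_eq[OF assms] by (simp add: coeff_eq_0)
  qed (simp add: poly_monom)
  finally show ?thesis .
qed

definition nontrivial_roots_poly :: "nat \<Rightarrow> complex poly" where
  "nontrivial_roots_poly N = (\<Prod>k=1..<N. zeta_factor N (int k))"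

lemma nontrivial_roots_poly_nonzero: "nontrivial_roots_poly N \<noteq> 0"
  by (simp add: nontrivial_roots_poly_def)

lemma N_poly_eq: "N_poly r l = nontrivial_roots_poly (l + r + 1) ^ r"
proof -
  let ?N = "l + r + 1"
  have "{..<?N} = insert 0 {1..<?N}" by auto
  then have "monom 1 ?N - 1 = zeta_factor ?N 0 * nontrivial_roots_poly ?N"
    using prod_all_zeta_factors[of ?N] by (simp add: nontrivial_roots_poly_def)
  moreover have "(monom 1 1 - 1 :: complex poly) \<noteq> 0"
    using zeta_factor_nonzero[of ?N 0] unfolding zeta_factor_0 .
  ultimately have "(monom 1 ?N - 1) div (monom 1 1 - 1) = nontrivial_roots_poly ?N"
    unfolding zeta_factor_0 by simp
  then show ?thesis by (simp only: N_poly_def)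
qed

lemma inj_on_unit_vec_diff:
  "inj_on (\<lambda>(i, j). unit_vec n i - unit_vec n j :: real vec) {(i, j). i < n \<and> j < n \<and> i \<noteq> j}"
proof (rule inj_onI, clarify)
  fix i j i' j' :: nat
  assume ij: "i < n" "j < n" "i \<noteq> j" "i' < n" "j' < n" "i' \<noteq> j'"
    and eq: "unit_vec n i - unit_vec n j = (unit_vec n i' - unit_vec n j' :: real vec)"
  have *: "vec_index (unit_vec n i - unit_vec n j :: real vec) k
      = vec_index (unit_vec n i' - unit_vec n j') k" for k
    using eq by simp
  show "i = i' \<and> j = j'"
    using *[of i] *[of j] ij by (auto simp: unit_vec_def split: if_splits)
qed

text \<open>Coordinate \<open>k\<close>, counted from 0, equals 1 in \<open>r - k\<close> positive
  roots and -1 in \<open>k\<close> of them.\<close>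

lemma rho_A_nth:
  assumes "k < r + 1"
  shows "vec_index (rho_A r) k = (real r - 2 * real k) / 2"
proof -
  let ?S = "{(i, j). i < j \<and> j < r + 1}"
  let ?f = "\<lambda>(i, j). unit_vec (r + 1) i - unit_vec (r + 1) j :: real vec"
  have inj: "inj_on ?f ?S"
    by (rule inj_on_subset[OF inj_on_unit_vec_diff]) auto
  have img: "positive_roots_A r = ?f ` ?S" by (auto simp: positive_roots_A_def)
  have fin: "finite ?S" by (rule finite_subset[of _ "{..r} \<times> {..r}"]) auto
  have "(\<Sum>\<alpha>\<in>positive_roots_A r. vec_index \<alpha> k) = (\<Sum>p\<in>?S. vec_index (?f p) k)"
    unfolding img sum.reindex[OF inj] by (simp only: o_def)
  also have "\<dots> = (\<Sum>(i, j)\<in>?S. (if i = k then 1 else 0) - (if j = k then 1 else 0))"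
    using assms by (intro sum.cong refl) (auto simp: unit_vec_def)
  also have "\<dots> = (\<Sum>(i, j)\<in>?S. if i = k then 1 else 0) - (\<Sum>(i, j)\<in>?S. if j = k then 1 else 0)"
    by (simp add: sum_subtractf case_prod_unfold)
  also have "(\<Sum>(i, j)\<in>?S. if i = k then 1 else 0 :: real) = real (card (?S \<inter> {p. fst p = k}))"
    using fin by (simp add: case_prod_unfold sum.If_cases)
  also have "?S \<inter> {p. fst p = k} = Pair k ` {k + 1..r}" by auto
  also have "card \<dots> = r - k" by (simp add: card_image inj_on_def)
  also have "(\<Sum>(i, j)\<in>?S. if j = k then 1 else 0 :: real) = real (card (?S \<inter> {p. snd p = k}))"
    using fin by (simp add: case_prod_unfold sum.If_cases)
  also have "?S \<inter> {p. snd p = k} = (\<lambda>i. (i, k)) ` {..<k}" using assms by auto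
  also have "card \<dots> = k" by (simp add: card_image inj_on_def)
  finally show ?thesis using assms by (simp add: rho_A_def of_nat_diff)
qed

text \<open>The pairing of \<open>rho_A\<close> with the root of the pair \<open>(i, j)\<close> is
  \<open>j - i\<close>. By \<open>inj_on_unit_vec_diff\<close> a product over the set of roots is a
  product over ordered pairs of distinct indices.\<close>

lemma D_poly_eq:
  "D_poly r l = (\<Prod>i\<le>r. \<Prod>j\<in>{..r} - {i}. zeta_factor (l + r + 1) (int j - int i))"
proof -
  let ?S = "Sigma {..r} (\<lambda>i. {..r} - {i})"
  let ?f = "\<lambda>(i, j). unit_vec (r + 1) i - unit_vec (r + 1) j :: real vec"
  let ?g = "\<lambda>\<alpha>. [:- exp (2 * of_real pi * \<i> * of_real (scalar_prod (rho_A r) \<alpha>) / of_nat (l + r + 1)), 1:]"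
  have inj: "inj_on ?f ?S"
    by (rule inj_on_subset[OF inj_on_unit_vec_diff]) auto
  have img: "roots_A r = ?f ` ?S" by (force simp: roots_A_def)
  have rho: "rho_A r \<in> carrier_vec (r + 1)" by (simp add: rho_A_def)
  have "?g (?f (i, j)) = zeta_factor (l + r + 1) (int j - int i)" if "i \<le> r" "j \<le> r" for i j
  proof -
    have "scalar_prod (rho_A r) (?f (i, j)) = vec_index (rho_A r) i - vec_index (rho_A r) j"
      using that rho by (simp add: scalar_prod_minus_distrib[of _ "r + 1"])
    also have "\<dots> = real j - real i" using that by (simp add: rho_A_nth field_simps)
    finally have "scalar_prod (rho_A r) (?f (i, j)) = real j - real i" .
    then show ?thesis by (simp add: zeta_factor_def cis_conv_exp mult_ac)
  qed
  then have "D_poly r l = (\<Prod>(i, j)\<in>?S. zeta_factor (l + r + 1) (int j - int i))"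
    unfolding D_poly_def img prod.reindex[OF inj] by (intro prod.cong refl) auto
  then show ?thesis by (simp add: prod.Sigma)
qed

section \<open>Cancelling D against N\<close>

lemma D_poly_nonzero: "D_poly r l \<noteq> 0"
  by (simp add: D_poly_eq)

text \<open>In row \<open>i\<close> the exponents \<open>j - i\<close> form a window of
  \<open>r + 1\<close> consecutive integers around 0. Modulo \<open>r + 3\<close> this window misses
  exactly the two residues supplied by the second factor.\<close>

lemma row_product:
  assumes "i \<le> r"
  shows "(\<Prod>j\<in>{..r} - {i}. zeta_factor (r + 3) (int j - int i)) *
    (zeta_factor (r + 3) (int (r - i + 1)) * zeta_factor (r + 3) (int (r - i + 2))) = nontrivial_roots_poly (r + 3)"
proof -
  let ?z = "\<lambda>k. zeta_factor (r + 3) (int k)"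
  have "(\<Prod>j=i+1..r. zeta_factor (r + 3) (int j - int i)) = (\<Prod>k=1..r-i. ?z k)"
    by (rule prod.reindex_bij_witness[of _ "\<lambda>k. k + i" "\<lambda>j. j - i"]) (use assms in \<open>auto simp: of_nat_diff\<close>)
  \<comment> \<open>The negative exponents are shifted up by \<open>r + 3\<close> and fill the end
    of the range.\<close>
  moreover have "(\<Prod>j<i. zeta_factor (r + 3) (int j - int i)) = (\<Prod>k=r-i+3..<r+3. ?z k)"
  proof (rule prod.reindex_bij_witness[of _ "\<lambda>k. k + i - (r + 3)" "\<lambda>j. j + (r + 3) - i"])
    fix j assume "j \<in> {..<i}"
    then have "int (j + (r + 3) - i) = (int j - int i) + int (r + 3)" using assms by simp
    then show "?z (j + (r + 3) - i) = zeta_factor (r + 3) (int j - int i)"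
      by (simp only: zeta_factor_mod)
  qed (use assms in auto)
  moreover have "{..r} - {i} = {i+1..r} \<union> {..<i}" using assms by auto
  moreover have "{i+1..r} \<inter> {..<i} = {}" by auto
  ultimately have "(\<Prod>j\<in>{..r} - {i}. zeta_factor (r + 3) (int j - int i))
     = (\<Prod>k=1..r-i. ?z k) * (\<Prod>k=r-i+3..<r+3. ?z k)"
    by (simp only: prod.union_disjoint finite_atLeastAtMost finite_lessThan)
  moreover have "{1..<r+3} = {1..r-i} \<union> ({r-i+1, r-i+2} \<union> {r-i+3..<r+3})" using assms by auto
  then have "nontrivial_roots_poly (r + 3) = (\<Prod>k=1..r-i. ?z k) * ((?z (r-i+1) * ?z (r-i+2)) * (\<Prod>k=r-i+3..<r+3. ?z k))"
  proof -
    have "{1..r-i} \<inter> ({r-i+1, r-i+2} \<union> {r-i+3..<r+3}) = {}" "{r-i+1, r-i+2} \<inter> {r-i+3..<r+3} = {}"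
      by auto
    then have "prod ?z {1..<r+3} = prod ?z {1..r-i} * (prod ?z {r-i+1, r-i+2} * prod ?z {r-i+3..<r+3})"
      unfolding \<open>{1..<r+3} = _\<close> by (subst prod.union_disjoint; auto simp: prod.union_disjoint)
    then show ?thesis by (simp add: nontrivial_roots_poly_def)
  qed
  ultimately show ?thesis by (simp add: mult_ac)
qed

text \<open>Over all \<open>r + 1\<close> rows the missing residues run through 1, ..., r + 1 and
  through 2, ..., r + 2. Together these are all nonzero residues once and 2, ..., r + 1 once more.
  One copy of \<open>nontrivial_roots_poly\<close> cancels.\<close>

lemma N_poly_eq_D_poly_mult_level_2:
  "N_poly r 2 = D_poly r 2 * (\<Prod>m=2..r+1. zeta_factor (r + 3) (int m))"
proof -
  let ?z = "\<lambda>k. zeta_factor (r + 3) (int k)"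
  let ?Q = "\<Prod>m=2..r+1. ?z m"
  have "D_poly r 2 * (\<Prod>i\<le>r. ?z (r - i + 1) * ?z (r - i + 2)) = nontrivial_roots_poly (r + 3) ^ (r + 1)"
  proof -
    have "2 + r + 1 = r + 3" by simp
    then have "D_poly r 2 * (\<Prod>i\<le>r. ?z (r - i + 1) * ?z (r - i + 2)) = (\<Prod>i\<le>r. nontrivial_roots_poly (r + 3))"
      unfolding D_poly_eq prod.distrib[symmetric] by (intro prod.cong) (simp_all only: row_product atMost_iff)
    then show ?thesis by (simp only: prod_constant card_atMost Suc_eq_plus1)
  qed
  moreover have "(\<Prod>i\<le>r. ?z (r - i + 1) * ?z (r - i + 2)) = nontrivial_roots_poly (r + 3) * ?Q"
  proof -
    have "(\<Prod>i\<le>r. ?z (r - i + 1) * ?z (r - i + 2)) = (\<Prod>i\<le>r. ?z (i + 1) * ?z (i + 2))"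
      by (rule prod.reindex_bij_witness[of _ "\<lambda>i. r - i" "\<lambda>i. r - i"]) auto
    also have "\<dots> = (\<Prod>i\<le>r. ?z (i + 1)) * (\<Prod>i\<le>r. ?z (i + 2))" by (rule prod.distrib)
    also have "(\<Prod>i\<le>r. ?z (i + 1)) = (\<Prod>m=1..r+1. ?z m)"
      by (rule prod.reindex_bij_witness[of _ "\<lambda>i. i - 1" "\<lambda>i. i + 1"]) auto
    also have "{1..r+1} = insert 1 {2..r+1}" by auto
    also have "(\<Prod>i\<le>r. ?z (i + 2)) = (\<Prod>m=2..r+2. ?z m)"
      by (rule prod.reindex_bij_witness[of _ "\<lambda>i. i - 2" "\<lambda>i. i + 2"]) auto
    also have "nontrivial_roots_poly (r + 3) = ?z 1 * (\<Prod>m=2..r+2. ?z m)"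
    proof -
      have "{1..<r+3} = insert 1 {2..r+2}" by auto
      then show ?thesis by (simp add: nontrivial_roots_poly_def)
    qed
    ultimately show ?thesis by (simp add: mult_ac)
  qed
  ultimately have prod_eq: "D_poly r 2 * (nontrivial_roots_poly (r + 3) * ?Q) = nontrivial_roots_poly (r + 3) ^ (r + 1)" by simp
  have "nontrivial_roots_poly (r + 3) * (D_poly r 2 * ?Q) = nontrivial_roots_poly (r + 3) * N_poly r 2"
  proof -
    have "2 + r + 1 = r + 3" by simp
    then have "N_poly r 2 = nontrivial_roots_poly (r + 3) ^ r" by (simp only: N_poly_eq)
    then have "nontrivial_roots_poly (r + 3) * N_poly r 2 = nontrivial_roots_poly (r + 3) ^ (r + 1)" by simp
    with prod_eq show ?thesis by (simp only: mult_ac)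
  qed
  then show ?thesis using nontrivial_roots_poly_nonzero by simp
qed

text \<open>The two roots contribute the exponents 1 and -1, and -1 is congruent to
  \<open>l + 1\<close> modulo \<open>l + 2\<close>.\<close>

lemma N_poly_eq_D_poly_mult_rank_1:
  assumes "l \<ge> 2"
  shows "N_poly 1 l = D_poly 1 l * (\<Prod>m=2..l. zeta_factor (l + 2) (int m))"
proof -
  have "{..1::nat} - {0} = {1}" "{..1::nat} - {1} = {0}" by auto
  then have "D_poly 1 l = zeta_factor (l + 2) 1 * zeta_factor (l + 2) (-1)"
    by (simp add: D_poly_eq)
  moreover have "zeta_factor (l + 2) (-1) = zeta_factor (l + 2) (int (l + 1))"
    using zeta_factor_mod[of "l + 2" "-1"] by (simp add: algebra_simps)
  moreover have "{1..<l+2} = {1, l + 1} \<union> {2..l}" using assms by auto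
  then have "nontrivial_roots_poly (l + 2) = zeta_factor (l + 2) 1 * zeta_factor (l + 2) (int (l + 1))
      * (\<Prod>m=2..l. zeta_factor (l + 2) (int m))"
    using assms unfolding nontrivial_roots_poly_def by (simp add: prod.union_disjoint)
  ultimately show ?thesis by (simp add: N_poly_eq)
qed

section \<open>The Jacobian of the loop on a path\<close>

text \<open>The logarithmic derivative in multiplied-out form, so that the product rule needs no
  nonvanishing hypotheses.\<close>

definition has_log_deriv :: "(real \<Rightarrow> real) \<Rightarrow> real \<Rightarrow> real \<Rightarrow> bool" where
  "has_log_deriv f d a \<longleftrightarrow> (f has_field_derivative f a * d) (at a)"

lemma has_log_deriv_mult:
  assumes "has_log_deriv f d a" "has_log_deriv g e a"
  shows "has_log_deriv (\<lambda>x. f x * g x) (d + e) a"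
  using assms unfolding has_log_deriv_def
  by (auto intro!: derivative_eq_intros simp: algebra_simps)

lemma has_log_deriv_prod:
  assumes "\<And>k. k \<in> S \<Longrightarrow> has_log_deriv (f k) (d k) a"
  shows "has_log_deriv (\<lambda>x. \<Prod>k\<in>S. f k x) (\<Sum>k\<in>S. d k) a"
  using assms
proof (induction S rule: infinite_finite_induct)
  case (insert k S)
  then show ?case using has_log_deriv_mult[of "f k" "d k" a "\<lambda>x. \<Prod>k\<in>S. f k x"] by simp
qed (simp_all add: has_log_deriv_def)

lemma has_log_deriv_inverse:
  assumes "has_log_deriv f d a" "f a \<noteq> 0"
  shows "has_log_deriv (\<lambda>x. inverse (f x)) (- d) a"
  using assms unfolding has_log_deriv_def
  by (auto intro!: derivative_eq_intros simp: field_simps)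

text \<open>The number \<open>e\<close> belongs to differentiation by the argument of
  \<open>h\<close>, not by its logarithm; this is where the factor \<open>f a\<close> comes
  from.\<close>

lemma has_log_deriv_chain:
  assumes "has_log_deriv f d a" "has_log_deriv h e (f a)"
  shows "has_log_deriv (\<lambda>x. h (f x)) (f a * e * d) a"
proof -
  have "((h \<circ> f) has_field_derivative (h (f a) * e) * (f a * d)) (at a)"
    using assms unfolding has_log_deriv_def by (intro DERIV_chain) auto
  then show ?thesis by (simp add: has_log_deriv_def o_def mult_ac)
qed

lemma has_log_deriv_coordinate:
  assumes "y q \<noteq> 0"
  shows "has_log_deriv (\<lambda>x. (y(q := x)) k) (if k = q then 1 / y q else 0) (y q)"
  using assms by (cases "k = q") (simp_all add: has_log_deriv_def)

section \<open>Two rounds of mutations on a path\<close>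

definition nbrs :: "nat \<Rightarrow> nat \<Rightarrow> nat set" where
  "nbrs n j = {k. k < n \<and> (k = Suc j \<or> j = Suc k)}"

lemma finite_nbrs [simp]: "finite (nbrs n j)"
  by (simp add: nbrs_def)

lemma nbrs_less: "k \<in> nbrs n j \<Longrightarrow> k < n"
  by (simp add: nbrs_def)

lemma nbrs_decomp:
  assumes "j < n"
  shows "nbrs n j = (if j > 0 then {j - 1} else {}) \<union> (if Suc j < n then {Suc j} else {})"
  using assms by (auto simp: nbrs_def)

lemma sum_nbrs:
  fixes f :: "nat \<Rightarrow> 'a :: comm_monoid_add"
  assumes "j < n"
  shows "sum f (nbrs n j) = (if j > 0 then f (j - 1) else 0) + (if Suc j < n then f (Suc j) else 0)"
  unfolding nbrs_decomp[OF assms] by (subst sum.union_disjoint) auto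

lemma prod_nbrs:
  fixes f :: "nat \<Rightarrow> 'a :: comm_monoid_mult"
  assumes "j < n"
  shows "prod f (nbrs n j) = (if j > 0 then f (j - 1) else 1) * (if Suc j < n then f (Suc j) else 1)"
  unfolding nbrs_decomp[OF assms] by (subst prod.union_disjoint) auto

text \<open>The value after the first round at a vertex not mutated in it; \<open>h\<close> is the
  factor acquired from each mutated neighbour.\<close>

definition half_loop :: "(real \<Rightarrow> real) \<Rightarrow> nat \<Rightarrow> (nat \<Rightarrow> real) \<Rightarrow> nat \<Rightarrow> real" where
  "half_loop h n y j = y j * (\<Prod>k\<in>nbrs n j. h (y k))"

text \<open>A plus vertex is inverted first and then collects the factors of the second round; a
  minus vertex collects factors first and is inverted last.\<close>

definition path_loop ::
  "(real \<Rightarrow> real) \<Rightarrow> nat \<Rightarrow> (nat \<Rightarrow> bool) \<Rightarrow> (nat \<Rightarrow> real) \<Rightarrow> nat \<Rightarrow> real" where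
  "path_loop h n is_plus y i =
     (if is_plus i then inverse (y i) * (\<Prod>j\<in>nbrs n i. h (half_loop h n y j))
      else inverse (half_loop h n y i))"

text \<open>The partial derivative of \<open>log (y k)\<close> with respect to
  \<open>y q\<close>.\<close>

definition coord_weight :: "(nat \<Rightarrow> real) \<Rightarrow> nat \<Rightarrow> nat \<Rightarrow> real" where
  "coord_weight y q k = (if k = q then 1 / y q else 0)"

text \<open>The partial derivative of \<open>log (half_loop h n y j)\<close> with respect to
  \<open>y q\<close>, where \<open>e\<close> is the logarithmic derivative of
  \<open>h\<close>.\<close>

definition half_weight :: "(real \<Rightarrow> real) \<Rightarrow> nat \<Rightarrow> (nat \<Rightarrow> real) \<Rightarrow> nat \<Rightarrow> nat \<Rightarrow> real" where
  "half_weight e n y q j = coord_weight y q j + (\<Sum>k\<in>nbrs n j. y k * e (y k) * coord_weight y q k)"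

lemma half_loop_log_deriv:
  assumes pos: "\<And>k. k < n \<Longrightarrow> y k > 0"
    and h: "\<And>x. x > 0 \<Longrightarrow> has_log_deriv h (e x) x"
    and "j < n" "q < n"
  shows "has_log_deriv (\<lambda>x. half_loop h n (y(q := x)) j) (half_weight e n y q j) (y q)"
  unfolding half_loop_def half_weight_def coord_weight_def
proof (intro has_log_deriv_mult has_log_deriv_prod)
  have q: "y q \<noteq> 0" using pos[OF \<open>q < n\<close>] by simp
  show "has_log_deriv (\<lambda>x. (y(q := x)) j) (if j = q then 1 / y q else 0) (y q)"
    by (rule has_log_deriv_coordinate) (rule q)
  fix k assume "k \<in> nbrs n j"
  then have "y k > 0" by (intro pos nbrs_less)
  then show "has_log_deriv (\<lambda>x. h ((y(q := x)) k)) (y k * e (y k) * (if k = q then 1 / y q else 0)) (y q)"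
    using has_log_deriv_chain[OF has_log_deriv_coordinate[of y q k, OF q], of h "e (y k)"] h[of "y k"]
    by simp
qed

lemma half_loop_pos:
  assumes "\<And>k. k < n \<Longrightarrow> y k > 0" "\<And>x. x > 0 \<Longrightarrow> h x > (0::real)" "j < n"
  shows "half_loop h n y j > 0"
  unfolding half_loop_def using assms by (auto intro!: mult_pos_pos prod_pos dest: nbrs_less)

lemma path_loop_log_deriv:
  assumes pos: "\<And>k. k < n \<Longrightarrow> y k > 0"
    and h: "\<And>x. x > 0 \<Longrightarrow> has_log_deriv h (e x) x" "\<And>x. x > 0 \<Longrightarrow> h x > 0"
    and "i < n" "q < n"
  shows "has_log_deriv (\<lambda>x. path_loop h n is_plus (y(q := x)) i)
    (if is_plus i then - coord_weight y q i + (\<Sum>j\<in>nbrs n i.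
         half_loop h n y j * e (half_loop h n y j) * half_weight e n y q j)
     else - half_weight e n y q i) (y q)"
proof -
  have q: "y q \<noteq> 0" "y i \<noteq> 0" using pos[OF \<open>q < n\<close>] pos[OF \<open>i < n\<close>] by simp_all
  have hp: "half_loop h n y j > 0" if "j < n" for j
    using pos h(2) that by (rule half_loop_pos)
  show ?thesis
  proof (cases "is_plus i")
    case True
    have "has_log_deriv (\<lambda>x. inverse ((y(q := x)) i)) (- coord_weight y q i) (y q)"
      unfolding coord_weight_def
      using q by (intro has_log_deriv_inverse has_log_deriv_coordinate) auto
    moreover have "has_log_deriv (\<lambda>x. \<Prod>j\<in>nbrs n i. h (half_loop h n (y(q := x)) j))
       (\<Sum>j\<in>nbrs n i. half_loop h n y j * e (half_loop h n y j) * half_weight e n y q j) (y q)"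
    proof (intro has_log_deriv_prod)
      fix j assume "j \<in> nbrs n i"
      then have "j < n" by (rule nbrs_less)
      then have "has_log_deriv (\<lambda>x. half_loop h n (y(q := x)) j) (half_weight e n y q j) (y q)"
        using pos h(1) \<open>q < n\<close> by (intro half_loop_log_deriv)
      from has_log_deriv_chain[OF this, of h "e (half_loop h n y j)"] h(1)[OF hp[OF \<open>j < n\<close>]]
      show "has_log_deriv (\<lambda>x. h (half_loop h n (y(q := x)) j))
        (half_loop h n y j * e (half_loop h n y j) * half_weight e n y q j) (y q)" by simp
    qed
    ultimately show ?thesis using True unfolding path_loop_def
      by (simp only: if_True has_log_deriv_mult)
  next
    case False
    have "has_log_deriv (\<lambda>x. half_loop h n (y(q := x)) i) (half_weight e n y q i) (y q)"
      using pos h(1) \<open>i < n\<close> \<open>q < n\<close> by (rule half_loop_log_deriv)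
    from has_log_deriv_inverse[OF this] show ?thesis
      using hp[OF \<open>i < n\<close>] False unfolding path_loop_def by simp
  qed
qed

definition path_jacobian ::
  "(real \<Rightarrow> real) \<Rightarrow> nat \<Rightarrow> (nat \<Rightarrow> bool) \<Rightarrow> (nat \<Rightarrow> real) \<Rightarrow> real mat" where
  "path_jacobian h n is_plus y =
     mat n n (\<lambda>(i, q). deriv (\<lambda>x. path_loop h n is_plus (y(q := x)) i) (y q))"

section \<open>Eigenvectors in logarithmic coordinates\<close>

lemma sum_coord_weight:
  fixes x :: "nat \<Rightarrow> complex"
  assumes "\<And>k. k < n \<Longrightarrow> y k > 0" "k < n"
  shows "(\<Sum>q<n. of_real (coord_weight y q k) * (of_real (y q) * x q)) = x k"
proof -
  have "(\<Sum>q<n. of_real (coord_weight y q k) * (of_real (y q) * x q))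
      = (\<Sum>q<n. if q = k then x k else 0)"
    using assms(1)[OF assms(2)] by (intro sum.cong refl) (auto simp: coord_weight_def)
  then show ?thesis using assms(2) by simp
qed

text \<open>The linearized first round: \<open>x\<close> is a tangent vector in the coordinates
  \<open>log y\<close>, and the factor \<open>y q\<close> converts it to the coordinates
  \<open>y\<close>.\<close>

lemma sum_half_weight:
  fixes x :: "nat \<Rightarrow> complex"
  assumes "\<And>k. k < n \<Longrightarrow> y k > 0" "j < n"
  shows "(\<Sum>q<n. of_real (half_weight e n y q j) * (of_real (y q) * x q))
    = x j + (\<Sum>k\<in>nbrs n j. of_real (y k * e (y k)) * x k)"
proof -
  have "(\<Sum>q<n. of_real (half_weight e n y q j) * (of_real (y q) * x q))
     = (\<Sum>q<n. of_real (coord_weight y q j) * (of_real (y q) * x q)) +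
       (\<Sum>q<n. \<Sum>k\<in>nbrs n j. of_real (y k * e (y k)) * (of_real (coord_weight y q k) * (of_real (y q) * x q)))"
    by (simp add: half_weight_def algebra_simps sum.distrib sum_distrib_left)
  also have "(\<Sum>q<n. \<Sum>k\<in>nbrs n j. of_real (y k * e (y k)) * (of_real (coord_weight y q k) * (of_real (y q) * x q)))
     = (\<Sum>k\<in>nbrs n j. \<Sum>q<n. of_real (y k * e (y k)) * (of_real (coord_weight y q k) * (of_real (y q) * x q)))"
    by (rule sum.swap)
  also have "\<dots> = (\<Sum>k\<in>nbrs n j. of_real (y k * e (y k)) * x k)"
    using sum_coord_weight[of n y] assms nbrs_less
    by (intro sum.cong refl) (simp add: sum_distrib_left[symmetric] del: of_real_mult)
  finally show ?thesis using sum_coord_weight[of n y] assms by simp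
qed

text \<open>At a fixed point both rounds are linearized with the same weights \<open>p\<close>: the
  numbers \<open>z\<close> are the plus coordinates before the first round and the minus coordinates
  after it. On the vector \<open>x\<close> built from \<open>w\<close>, each round reduces to the
  tridiagonal equation for \<open>w\<close>.\<close>

lemma path_jacobian_eigenvalue:
  fixes e h :: "real \<Rightarrow> real"
  assumes pos: "\<And>k. k < n \<Longrightarrow> y k > 0"
    and h: "\<And>x. x > 0 \<Longrightarrow> has_log_deriv h (e x) x" "\<And>x. x > 0 \<Longrightarrow> h x > 0"
    and fixpt: "\<And>i. i < n \<Longrightarrow> path_loop h n is_plus y i = y i"
    and alt: "\<And>i j. j \<in> nbrs n i \<Longrightarrow> i < n \<Longrightarrow> is_plus j \<longleftrightarrow> \<not> is_plus i"
    and wt: "\<And>i. i < n \<Longrightarrow> z i = (if is_plus i then y i else inverse (y i))"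
      "\<And>i. i < n \<Longrightarrow> p i = z i * e (z i)"
    and w: "\<And>i. i < n \<Longrightarrow> (\<Sum>j\<in>nbrs n i. p j * w j) = 2 * cos \<psi> * w i"
    and ne: "n > 0" "w 0 \<noteq> 0"
  shows "eigenvalue (map_mat complex_of_real (path_jacobian h n is_plus y)) (cis (2 * \<psi>))"
proof -
  define \<mu> where "\<mu> = cis \<psi>"
  \<comment> \<open>The factor \<open>- \<mu>\<close> on the plus vertices is chosen so that the
    first round multiplies the minus entries by \<open>- \<mu> ^ 2\<close>; the inversion then gives
    the eigenvalue.\<close>
  define x :: "nat \<Rightarrow> complex" where "x i = (if is_plus i then - \<mu> * of_real (w i) else of_real (w i))" for i
  define M where "M = map_mat complex_of_real (path_jacobian h n is_plus y)"
  define X where "X = vec n (\<lambda>q. complex_of_real (y q) * x q)"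
  define D where "D i q = (if is_plus i then - coord_weight y q i + (\<Sum>j\<in>nbrs n i.
         half_loop h n y j * e (half_loop h n y j) * half_weight e n y q j)
     else - half_weight e n y q i)" for i q
  have \<mu>2: "\<mu> ^ 2 = cis (2 * \<psi>)" unfolding \<mu>_def by (simp add: power2_eq_square cis_mult)
  \<comment> \<open>That is, \<mu> is a root of the quadratic polynomial with root sum 2 cos \<psi>
    and root product 1.\<close>
  have \<mu>c: "\<mu> * of_real (2 * cos \<psi>) = 1 + \<mu> ^ 2"
    by (simp add: \<mu>_def complex_eq_iff power2_eq_square cis.sel algebra_simps)
  have entry: "M $$ (i, q) = of_real (y i) * of_real (D i q)" if "i < n" "q < n" for i q
  proof -
    have "deriv (\<lambda>x. path_loop h n is_plus (y(q := x)) i) (y q) = path_loop h n is_plus (y(q := y q)) i * D i q"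
      using path_loop_log_deriv[OF pos h that, where is_plus = is_plus]
      unfolding has_log_deriv_def D_def by (rule DERIV_imp_deriv)
    then show ?thesis using that fixpt by (simp add: M_def path_jacobian_def)
  qed
  \<comment> \<open>The loop ends by inverting the minus coordinates, so before that they are the
    inverses of the fixed values.\<close>
  have half: "half_loop h n y i = inverse (y i)" if "i < n" "\<not> is_plus i" for i
    using fixpt[OF that(1)] that(2) by (simp add: path_loop_def) (metis inverse_inverse_eq)
  have S: "(\<Sum>q<n. of_real (half_weight e n y q j) * (of_real (y q) * x q)) = - (\<mu> ^ 2) * of_real (w j)"
    if j: "j < n" "\<not> is_plus j" for j
  proof -
    have "(\<Sum>k\<in>nbrs n j. of_real (y k * e (y k)) * x k) = (\<Sum>k\<in>nbrs n j. - \<mu> * of_real (p k * w k))"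
    proof (intro sum.cong refl)
      fix k assume k: "k \<in> nbrs n j"
      then have "is_plus k" "k < n" using alt[OF k j(1)] j k nbrs_less by auto
      then show "of_real (y k * e (y k)) * x k = - \<mu> * of_real (p k * w k)"
        by (simp add: x_def wt)
    qed
    also have "\<dots> = - \<mu> * of_real (2 * cos \<psi> * w j)"
      unfolding sum_distrib_left[symmetric] of_real_sum[symmetric] w[OF j(1)] ..
    also have "\<dots> = - (1 + \<mu> ^ 2) * of_real (w j)"
      unfolding \<mu>c[symmetric] by simp
    finally have "(\<Sum>k\<in>nbrs n j. of_real (y k * e (y k)) * x k) = - (1 + \<mu> ^ 2) * of_real (w j)" .
    moreover have "x j = of_real (w j)" using j by (simp add: x_def)
    ultimately show ?thesis
      using sum_half_weight[of n y j e x, OF pos j(1)] by (simp only:) (simp add: algebra_simps)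
  qed
  have E: "(\<Sum>q<n. of_real (D i q) * (of_real (y q) * x q)) = \<mu> ^ 2 * x i" if i: "i < n" for i
  proof (cases "is_plus i")
    case False
    then have "(\<Sum>q<n. of_real (D i q) * (of_real (y q) * x q))
        = - (\<Sum>q<n. of_real (half_weight e n y q i) * (of_real (y q) * x q))"
      by (simp add: D_def sum_negf)
    then show ?thesis using S[OF i False] False by (simp add: x_def)
  next
    case True
    have nb: "j < n \<and> \<not> is_plus j" if "j \<in> nbrs n i" for j
      using alt[OF that i] True nbrs_less[OF that] by simp
    have "(\<Sum>q<n. of_real (D i q) * (of_real (y q) * x q))
        = - (\<Sum>q<n. of_real (coord_weight y q i) * (of_real (y q) * x q)) +
          (\<Sum>q<n. \<Sum>j\<in>nbrs n i. of_real (half_loop h n y j * e (half_loop h n y j)) *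
            (of_real (half_weight e n y q j) * (of_real (y q) * x q)))"
      using True by (simp add: D_def algebra_simps sum.distrib sum_negf sum_distrib_left sum_subtractf)
    also have "(\<Sum>q<n. of_real (coord_weight y q i) * (of_real (y q) * x q)) = x i"
      by (rule sum_coord_weight[OF pos i])
    also have "(\<Sum>q<n. \<Sum>j\<in>nbrs n i. of_real (half_loop h n y j * e (half_loop h n y j)) *
            (of_real (half_weight e n y q j) * (of_real (y q) * x q)))
       = (\<Sum>j\<in>nbrs n i. of_real (half_loop h n y j * e (half_loop h n y j)) *
            (\<Sum>q<n. of_real (half_weight e n y q j) * (of_real (y q) * x q)))"
      by (subst sum.swap) (simp only: sum_distrib_left)
    also have "\<dots> = (\<Sum>j\<in>nbrs n i. - (\<mu> ^ 2) * of_real (p j * w j))"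
      using nb by (intro sum.cong refl) (simp add: S half wt)
    also have "\<dots> = - (\<mu> ^ 2) * of_real (2 * cos \<psi> * w i)"
      unfolding sum_distrib_left[symmetric] of_real_sum[symmetric] w[OF i] ..
    also have "\<dots> = - \<mu> * (1 + \<mu> ^ 2) * of_real (w i)"
      unfolding \<mu>c[symmetric] by (simp add: power2_eq_square)
    also have "- x i + \<dots> = \<mu> ^ 2 * x i"
      using True by (simp add: x_def algebra_simps power2_eq_square)
    finally show ?thesis .
  qed
  have M: "M \<in> carrier_mat n n" by (simp add: M_def path_jacobian_def)
  have X: "X \<in> carrier_vec n" by (simp add: X_def)
  have "M *\<^sub>v X = \<mu> ^ 2 \<cdot>\<^sub>v X"
  proof (rule eq_vecI)
    fix i assume "i < dim_vec (\<mu> ^ 2 \<cdot>\<^sub>v X)"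
    then have i: "i < n" using X by simp
    have "vec_index (M *\<^sub>v X) i = (\<Sum>q<n. M $$ (i, q) * (of_real (y q) * x q))"
      using M i by (simp add: scalar_prod_def X_def lessThan_atLeast0)
    also have "\<dots> = of_real (y i) * (\<Sum>q<n. of_real (D i q) * (of_real (y q) * x q))"
      using i by (simp add: entry sum_distrib_left mult.assoc)
    also have "\<dots> = vec_index (\<mu> ^ 2 \<cdot>\<^sub>v X) i"
      unfolding E[OF i] using i by (simp add: X_def mult_ac)
    finally show "vec_index (M *\<^sub>v X) i = vec_index (\<mu> ^ 2 \<cdot>\<^sub>v X) i" .
  qed (use M X in auto)
  moreover have "X \<noteq> 0\<^sub>v n"
  proof
    assume "X = 0\<^sub>v n"
    then have "vec_index X 0 = 0" using ne by simp
    then show False using ne pos[of 0] by (auto simp: X_def x_def \<mu>_def split: if_splits)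
  qed
  ultimately show ?thesis
    using M X by (auto simp: eigenvalue_def eigenvector_def M_def[symmetric] \<mu>2)
qed

section \<open>Mutation at sources and sinks, evaluated at positive points\<close>

text \<open>Evaluation is defined by a description and respects the operations only where
  denominators do not vanish. Fractions with positive numerator and denominator values provide this
  at positive points.\<close>

lemma eval_ratfun_subtraction_free:
  assumes y: "\<And>i. i \<in> I \<Longrightarrow> y i > 0" and f: "f \<in> subtraction_free I" and g: "g \<in> subtraction_free I"
  shows eval_ratfun_add: "eval_ratfun y (f + g) = eval_ratfun y f + eval_ratfun y g"
    and eval_ratfun_mult: "eval_ratfun y (f * g) = eval_ratfun y f * eval_ratfun y g"
    and eval_ratfun_divide: "eval_ratfun y (f / g) = eval_ratfun y f / eval_ratfun y g"
proof -
  obtain p q where f': "f = Fraction_Field.Fract p q" "eval_mpoly y p > 0" "eval_mpoly y q > 0"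
    using subtraction_free_positive_fraction[OF f, of y] y by blast
  obtain p' q' where g': "g = Fraction_Field.Fract p' q'" "eval_mpoly y p' > 0" "eval_mpoly y q' > 0"
    using subtraction_free_positive_fraction[OF g, of y] y by blast
  have nz: "q \<noteq> 0" "q' \<noteq> 0" "p' \<noteq> 0" using f' g' by auto
  have ef: "eval_ratfun y f = eval_mpoly y p / eval_mpoly y q"
    and eg: "eval_ratfun y g = eval_mpoly y p' / eval_mpoly y q'"
    using f' g' by (simp_all add: eval_ratfun_Fract)
  have "f + g = Fraction_Field.Fract (p * q' + p' * q) (q * q')"
    "f * g = Fraction_Field.Fract (p * p') (q * q')" "f / g = Fraction_Field.Fract (p * q') (q * p')"
    using f' g' nz by simp_all
  then show "eval_ratfun y (f + g) = eval_ratfun y f + eval_ratfun y g"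
    "eval_ratfun y (f * g) = eval_ratfun y f * eval_ratfun y g"
    "eval_ratfun y (f / g) = eval_ratfun y f / eval_ratfun y g"
    using f' g' unfolding ef eg
    by (simp_all add: eval_ratfun_Fract eval_mpoly_mult eval_mpoly_add field_simps)
qed

lemma eval_ratfun_1: "eval_ratfun y 1 = 1"
  by (simp add: One_fract_def eval_ratfun_Fract)

lemma eval_ratfun_yvar: "eval_ratfun y (yvar i) = y i"
  by (simp add: yvar_def to_fract_def eval_ratfun_Fract eval_monom_def)

lemma subtraction_free_inverse: "f \<in> subtraction_free I \<Longrightarrow> inverse f \<in> subtraction_free I"
  using subtraction_free.divide[OF subtraction_free.one] by (simp add: inverse_eq_divide)

lemma subtraction_free_power: "f \<in> subtraction_free I \<Longrightarrow> f ^ n \<in> subtraction_free I"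
  by (induction n) (auto intro: subtraction_free.intros)

lemma eval_ratfun_inverse:
  assumes "\<And>i. i \<in> I \<Longrightarrow> y i > 0" "f \<in> subtraction_free I"
  shows "eval_ratfun y (inverse f) = inverse (eval_ratfun y f)"
  using eval_ratfun_divide[OF assms(1) subtraction_free.one assms(2)]
  by (simp add: inverse_eq_divide eval_ratfun_1)

lemma eval_ratfun_power:
  assumes "\<And>i. i \<in> I \<Longrightarrow> y i > 0" "f \<in> subtraction_free I"
  shows "eval_ratfun y (f ^ n) = eval_ratfun y f ^ n"
  by (induction n)
    (simp_all add: eval_ratfun_1 eval_ratfun_mult[OF assms(1) assms(2) subtraction_free_power[OF assms(2)]])

section \<open>Rounds of source or sink mutations\<close>

text \<open>The flag \<open>b\<close> distinguishes sources (\<open>True\<close>) from sinks (\<open>False\<close>); \<open>factor b\<close> is then the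
  factor acquired by a neighbour of the mutated vertex.\<close>

definition is_source_or_sink :: "bool \<Rightarrow> 'v quiver \<Rightarrow> 'v \<Rightarrow> bool" where
  "is_source_or_sink b Q k \<longleftrightarrow> (if b then \<forall>i. Q i k = 0 else \<forall>i. Q k i = 0)"

definition factor :: "bool \<Rightarrow> real \<Rightarrow> real" where
  "factor b x = (if b then inverse (inverse x + 1) else x + 1)"

text \<open>An arrow with both ends in \<open>X\<close> is reversed once here but twice by
  successive mutations; the two agree on sets without inner arrows.\<close>

definition reverse_set :: "'v set \<Rightarrow> 'v quiver \<Rightarrow> 'v quiver" where
  "reverse_set X Q = (\<lambda>i j. if i \<in> X \<or> j \<in> X then Q j i else Q i j)"

text \<open>No path runs through a source or a sink, so no arrow is added and no 2-cycle
  arises.\<close>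

lemma mutate_quiver_source:
  assumes "is_quiver I Q" "is_source_or_sink b Q k"
  shows "mutate_quiver k Q = reverse_at k Q"
proof -
  have "add_paths k Q = Q"
    using assms(2) by (auto simp: add_paths_def is_source_or_sink_def fun_eq_iff simp del: split_paired_All split: if_splits)
  moreover have "Q i j = 0 \<or> Q j i = 0" for i j using assms(1) unfolding is_quiver_def by metis
  then have "Q i j - Q j i = Q i j" for i j by (metis diff_zero diff_0_eq_0)
  then have "remove_2cycles (reverse_at k Q) = reverse_at k Q"
    by (simp add: remove_2cycles_def reverse_at_def fun_eq_iff)
  ultimately show ?thesis by (simp add: mutate_quiver_def)
qed

text \<open>One of the two summands in the exponent vanishes, so the same formula serves sources and
  sinks.\<close>

lemma eval_mutate_Y:
  assumes y: "\<And>i. i \<in> I \<Longrightarrow> y i > 0" and s: "is_Y_seed I (Q, Y)" and k: "k \<in> I" "is_source_or_sink b Q k"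
    and i: "i \<in> I"
  shows "eval_ratfun y (mutate_Y k Q Y i) =
    (if i = k then inverse (eval_ratfun y (Y k))
     else eval_ratfun y (Y i) * factor b (eval_ratfun y (Y k)) ^ (Q i k + Q k i))"
proof -
  have Y: "Y i \<in> subtraction_free I" "Y k \<in> subtraction_free I"
    using s i k by (auto simp: is_Y_seed_def)
  note one = subtraction_free.one[of I]
  have 1: "Y k + 1 \<in> subtraction_free I" "inverse (Y k) + 1 \<in> subtraction_free I"
    using Y by (auto intro: subtraction_free.intros subtraction_free_inverse)
  note ev = eval_ratfun_inverse[of I y, OF y] eval_ratfun_power[of I y, OF y]
    eval_ratfun_add[of I y, OF y _ one] eval_ratfun_mult[of I y, OF y] eval_ratfun_1
  show ?thesis
  proof (cases "i = k")
    case True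
    then show ?thesis using Y by (simp add: mutate_Y_def ev)
  next
    case False
    show ?thesis
    proof (cases b)
      case True
      then have "Q i k = 0" using k by (simp add: is_source_or_sink_def del: split_paired_All)
      then have "mutate_Y k Q Y i = Y i * (inverse (inverse (Y k) + 1)) ^ Q k i"
        using False by (simp add: mutate_Y_def power_int_minus power_inverse)
      then show ?thesis using False True Y 1 \<open>Q i k = 0\<close>
        by (simp add: ev subtraction_free_inverse subtraction_free_power factor_def)
    next
      case b: False
      then have "Q k i = 0" using k by (simp add: is_source_or_sink_def del: split_paired_All)
      then have "mutate_Y k Q Y i = Y i * (Y k + 1) ^ Q i k"
        using False by (simp add: mutate_Y_def)
      then show ?thesis using False b Y 1 \<open>Q k i = 0\<close>
        by (simp add: ev subtraction_free_power factor_def)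
    qed
  qed
qed

text \<open>Vertices of the same type are pairwise not adjacent. Each mutation therefore leaves the
  variables and the type of the others unchanged, and the result depends only on
  \<open>set ks\<close>.\<close>

lemma eval_fold_mutate_sources:
  assumes y: "\<And>i. i \<in> I \<Longrightarrow> y i > 0"
    and "is_Y_seed I (Q, Y)" "distinct ks" "set ks \<subseteq> I" "\<And>k. k \<in> set ks \<Longrightarrow> is_source_or_sink b Q k"
  shows "is_Y_seed I (fold mutate_seed ks (Q, Y))"
    and "fst (fold mutate_seed ks (Q, Y)) = reverse_set (set ks) Q"
    and "i \<in> I \<Longrightarrow> eval_ratfun y (snd (fold mutate_seed ks (Q, Y)) i) =
      (if i \<in> set ks then inverse (eval_ratfun y (Y i))
       else eval_ratfun y (Y i) * (\<Prod>k\<in>set ks. factor b (eval_ratfun y (Y k)) ^ (Q i k + Q k i)))"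
proof -
  have "is_Y_seed I (fold mutate_seed ks (Q, Y)) \<and>
    fst (fold mutate_seed ks (Q, Y)) = reverse_set (set ks) Q \<and>
    (\<forall>i\<in>I. eval_ratfun y (snd (fold mutate_seed ks (Q, Y)) i) =
      (if i \<in> set ks then inverse (eval_ratfun y (Y i))
       else eval_ratfun y (Y i) * (\<Prod>k\<in>set ks. factor b (eval_ratfun y (Y k)) ^ (Q i k + Q k i))))"
    using assms(2-)
  proof (induction ks arbitrary: Q Y)
    case Nil
    then show ?case by (simp add: reverse_set_def)
  next
    case (Cons k ks)
    define Q' where "Q' = reverse_at k Q"
    define Y' where "Y' = mutate_Y k Q Y"
    have k: "k \<in> I" "is_source_or_sink b Q k" using Cons.prems by simp_all
    have q: "is_quiver I Q" using Cons.prems(1) by (simp add: is_Y_seed_def)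
    have step: "mutate_seed k (Q, Y) = (Q', Y')"
      using mutate_quiver_source[OF q k(2)] by (simp add: mutate_seed_def Q'_def Y'_def)
    have seed: "is_Y_seed I (Q', Y')"
      using is_Y_seed_mutate[OF Cons.prems(1) k(1)] step by simp
    \<comment> \<open>An arrow between two of these vertices would enter a source or leave a
      sink.\<close>
    have ind: "Q j j' = 0" if "j \<in> insert k (set ks)" "j' \<in> insert k (set ks)" for j j'
      using Cons.prems(4)[of j] Cons.prems(4)[of j'] that by (auto simp: is_source_or_sink_def simp del: split_paired_All split: if_splits)
    have src: "is_source_or_sink b Q' j" if "j \<in> set ks" for j
      using Cons.prems(2) Cons.prems(4)[of j] that ind[of k j] ind[of j k]
      by (auto simp: is_source_or_sink_def Q'_def reverse_at_def simp del: split_paired_All split: if_splits)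
    have E: "Q' i j + Q' j i = Q i j + Q j i" for i j by (simp add: Q'_def reverse_at_def)
    have Y'_eq: "eval_ratfun y (Y' i) = (if i = k then inverse (eval_ratfun y (Y k))
     else eval_ratfun y (Y i) * factor b (eval_ratfun y (Y k)) ^ (Q i k + Q k i))" if "i \<in> I" for i
      unfolding Y'_def by (rule eval_mutate_Y[OF y Cons.prems(1) k that])
    have Y'_ks: "eval_ratfun y (Y' j) = eval_ratfun y (Y j)" if "j \<in> set ks" for j
      using Y'_eq[of j] that Cons.prems(2,3) ind[of j k] ind[of k j] by auto
    note IH = Cons.IH[OF seed _ _ src]
    have IH': "is_Y_seed I (fold mutate_seed ks (Q', Y'))"
      "fst (fold mutate_seed ks (Q', Y')) = reverse_set (set ks) Q'"
      "\<And>i. i \<in> I \<Longrightarrow> eval_ratfun y (snd (fold mutate_seed ks (Q', Y')) i) =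
      (if i \<in> set ks then inverse (eval_ratfun y (Y' i))
       else eval_ratfun y (Y' i) * (\<Prod>k\<in>set ks. factor b (eval_ratfun y (Y' k)) ^ (Q' i k + Q' k i)))"
      using IH Cons.prems by auto
    have "reverse_set (set ks) Q' = reverse_set (set (k # ks)) Q"
    proof (intro ext)
      fix i j
      show "reverse_set (set ks) Q' i j = reverse_set (set (k # ks)) Q i j"
        using Cons.prems(2) ind[of i j] ind[of j i] by (auto simp: reverse_set_def Q'_def reverse_at_def)
    qed
    moreover have "eval_ratfun y (snd (fold mutate_seed ks (Q', Y')) i) =
      (if i \<in> set (k # ks) then inverse (eval_ratfun y (Y i))
       else eval_ratfun y (Y i) * (\<Prod>k\<in>set (k # ks). factor b (eval_ratfun y (Y k)) ^ (Q i k + Q k i)))"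
      if i: "i \<in> I" for i
    proof -
      have P: "(\<Prod>j\<in>set ks. factor b (eval_ratfun y (Y' j)) ^ (Q' i j + Q' j i))
          = (\<Prod>j\<in>set ks. factor b (eval_ratfun y (Y j)) ^ (Q i j + Q j i))"
        by (intro prod.cong refl) (simp only: E Y'_ks)
      show ?thesis
      proof (cases "i \<in> set (k # ks)")
        case False
        then show ?thesis using Cons.prems(2) i unfolding IH'(3)[OF i] P
          by (simp add: Y'_eq mult.assoc)
      next
        case True
        show ?thesis
        proof (cases "i = k")
          case True
          have "(\<Prod>j\<in>set ks. factor b (eval_ratfun y (Y j)) ^ (Q k j + Q j k)) = 1"
            using ind by (intro prod.neutral) auto
          then show ?thesis using True Cons.prems(2) i unfolding IH'(3)[OF i] P by (simp add: Y'_eq)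
        next
          case False
          then show ?thesis using True unfolding IH'(3)[OF i] by (simp add: Y'_ks)
        qed
      qed
    qed
    ultimately show ?case using IH'(1,2) by (simp add: step)
  qed
  then show "is_Y_seed I (fold mutate_seed ks (Q, Y))"
    "fst (fold mutate_seed ks (Q, Y)) = reverse_set (set ks) Q"
    "i \<in> I \<Longrightarrow> eval_ratfun y (snd (fold mutate_seed ks (Q, Y)) i) =
      (if i \<in> set ks then inverse (eval_ratfun y (Y i))
       else eval_ratfun y (Y i) * (\<Prod>k\<in>set ks. factor b (eval_ratfun y (Y k)) ^ (Q i k + Q k i)))"
    by blast+
qed

text \<open>The first round reverses every arrow, so the vertices of the second round change to the
  type \<open>b\<close> and both rounds use the same \<open>factor b\<close>.\<close>

lemma eval_bipartite_loop:
  assumes y: "\<And>i. i \<in> I \<Longrightarrow> y i > 0" and q: "is_quiver I Q"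
    and ps: "distinct ps" "set ps \<subseteq> I" "\<And>k. k \<in> set ps \<Longrightarrow> is_source_or_sink b Q k"
    and ms: "distinct ms" "set ms = I - set ps" "\<And>k. k \<in> set ms \<Longrightarrow> is_source_or_sink (\<not> b) Q k"
    and i: "i \<in> I"
  defines "T \<equiv> \<lambda>i. y i * (\<Prod>k\<in>set ps. factor b (y k) ^ (Q i k + Q k i))"
  shows "eval_ratfun y (snd (fold mutate_seed (ps @ ms) (Q, yvar)) i) =
    (if i \<in> set ps then inverse (y i) * (\<Prod>k\<in>set ms. factor b (T k) ^ (Q i k + Q k i))
     else inverse (T i))"
proof -
  have seed: "is_Y_seed I (Q, yvar)" using q by (auto simp: is_Y_seed_def intro: subtraction_free.var)
  define Q1 where "Q1 = reverse_set (set ps) Q"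
  define Y1 where "Y1 = snd (fold mutate_seed ps (Q, yvar))"
  have first: "is_Y_seed I (fold mutate_seed ps (Q, yvar))"
    "fst (fold mutate_seed ps (Q, yvar)) = reverse_set (set ps) Q"
    by (rule eval_fold_mutate_sources(1,2)[where b = b]; use y seed ps in blast)+
  have s1: "fold mutate_seed ps (Q, yvar) = (Q1, Y1)"
    using first(2) by (simp add: Q1_def Y1_def prod_eq_iff)
  have Y1: "eval_ratfun y (Y1 i) = (if i \<in> set ps then inverse (y i) else T i)" if "i \<in> I" for i
  proof -
    have "eval_ratfun y (snd (fold mutate_seed ps (Q, yvar)) i) =
      (if i \<in> set ps then inverse (eval_ratfun y (yvar i)) else eval_ratfun y (yvar i) *
        (\<Prod>k\<in>set ps. factor b (eval_ratfun y (yvar k)) ^ (Q i k + Q k i)))"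
      using y seed ps that by (rule eval_fold_mutate_sources(3))
    then show ?thesis by (simp only: eval_ratfun_yvar T_def Y1_def)
  qed
  have out: "Q j k = 0" if "j \<notin> I \<or> k \<notin> I" for j k
    using q that unfolding is_quiver_def by metis
  \<comment> \<open>The vertices outside \<open>ps\<close> all have the opposite type, so no arrows
    join them and every arrow at \<open>k\<close> has been reversed.\<close>
  have src1: "is_source_or_sink b Q1 k" if k: "k \<in> set ms" for k
  proof -
    have *: "Q j k = 0 \<and> Q k j = 0" if "j \<notin> set ps" for j
    proof (cases "j \<in> I")
      case True
      then show ?thesis using ms(3)[OF k] ms(3)[of j] ms(2) that
        by (auto simp: is_source_or_sink_def simp del: split_paired_All split: if_splits)
    qed (simp add: out)
    have "k \<notin> set ps" using k ms(2) by simp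
    then show ?thesis using ms(3)[OF k] *
      by (auto simp: is_source_or_sink_def Q1_def reverse_set_def simp del: split_paired_All split: if_splits)
  qed
  have E: "Q1 i k + Q1 k i = Q i k + Q k i" for i k by (auto simp: Q1_def reverse_set_def)
  have seed1: "is_Y_seed I (Q1, Y1)" using first(1) s1 by simp
  have "set ms \<subseteq> I" using ms(2) by blast
  with y seed1 ms(1) have "eval_ratfun y (snd (fold mutate_seed ms (Q1, Y1)) i) =
      (if i \<in> set ms then inverse (eval_ratfun y (Y1 i))
       else eval_ratfun y (Y1 i) * (\<Prod>k\<in>set ms. factor b (eval_ratfun y (Y1 k)) ^ (Q i k + Q k i)))"
    using src1 i unfolding E[symmetric] by (rule eval_fold_mutate_sources(3))
  also have "(\<Prod>k\<in>set ms. factor b (eval_ratfun y (Y1 k)) ^ (Q i k + Q k i)) =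
      (\<Prod>k\<in>set ms. factor b (T k) ^ (Q i k + Q k i))"
    using ms(2) by (intro prod.cong refl) (auto simp: Y1)
  finally show ?thesis using i ms(2) by (simp add: s1 Y1)
qed

section \<open>The characteristic polynomial\<close>

lemma sin_triple_identity:
  fixes x y :: real
  shows "sin x * sin (3 * y) - sin (3 * x) * sin y = 4 * sin x * sin y * (sin (x - y) * sin (x + y))"
proof -
  have 3: "sin (3 * u) = 3 * sin u - 4 * sin u ^ 3" for u :: real
  proof -
    have "sin (3 * u) = sin (u + 2 * u)" by simp
    also have "\<dots> = sin u * (1 - 2 * sin u ^ 2) + cos u * (2 * sin u * cos u)"
      by (simp only: sin_add cos_double_sin sin_double)
    also have "cos u * (2 * sin u * cos u) = 2 * sin u * (1 - sin u ^ 2)"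
      unfolding cos_squared_eq[symmetric] by (simp add: power2_eq_square)
    finally show ?thesis by (simp add: algebra_simps power2_eq_square power3_eq_cube)
  qed
  have "sin (x - y) * sin (x + y) = sin x ^ 2 * cos y ^ 2 - cos x ^ 2 * sin y ^ 2"
    by (simp add: sin_add sin_diff algebra_simps power2_eq_square)
  also have "\<dots> = sin x ^ 2 - sin y ^ 2"
    unfolding cos_squared_eq by (simp add: algebra_simps)
  finally have p: "sin (x - y) * sin (x + y) = sin x ^ 2 - sin y ^ 2" .
  show ?thesis unfolding 3 p by (simp add: algebra_simps power2_eq_square power3_eq_cube)
qed

lemma sin_multiple_pos:
  assumes "1 \<le> i" "i < N"
  shows "sin (real i * (pi / real N)) > 0"
  using assms by (intro sin_gt_zero) (simp_all add: field_simps)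

text \<open>By \<open>sin_triple_identity\<close> the mode at node 1 is a nonzero multiple of a
  product containing \<open>sin (\<psi> - \<theta>)\<close> and
  \<open>sin (\<psi> + \<theta>)\<close> for \<open>\<psi> = m \<theta>\<close>. The bounds on
  \<open>m\<close> make both positive; at m = 1 and m = n + 2 one of them would vanish.\<close>

lemma path_mode_nonzero:
  assumes "2 \<le> m" "m \<le> n + 1"
  defines "\<theta> \<equiv> pi / real (n + 3)"
  shows "path_mode \<theta> (real m * \<theta>) 1 \<noteq> 0"
proof -
  note pos = sin_multiple_pos[of _ "n + 3", folded \<theta>_def]
  have s: "sin \<theta> > 0" "sin (2 * \<theta>) > 0" "sin (3 * \<theta>) > 0" "sin (real m * \<theta>) > 0"
    "sin (real (m - 1) * \<theta>) > 0" "sin (real (m + 1) * \<theta>) > 0"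
    using pos[of 1] pos[of 2] pos[of 3] pos[of m] pos[of "m - 1"] pos[of "m + 1"] assms(1,2) by simp_all
  have "real (m - 1) * \<theta> = real m * \<theta> - \<theta>" "real (m + 1) * \<theta> = real m * \<theta> + \<theta>"
    using assms(1) by (simp_all add: of_nat_diff algebra_simps)
  then have "4 * sin (real m * \<theta>) * sin \<theta> * (sin (real m * \<theta> - \<theta>) * sin (real m * \<theta> + \<theta>)) > 0"
    using s by simp
  then have "sin (real m * \<theta>) * sin (3 * \<theta>) - sin (3 * (real m * \<theta>)) * sin \<theta> > 0"
    unfolding sin_triple_identity .
  then have "sin (real m * \<theta>) / sin \<theta> \<noteq> sin (3 * (real m * \<theta>)) / sin (3 * \<theta>)"
    using s by (simp add: field_simps)
  then show ?thesis using s by (simp add: path_mode_def)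
qed

section \<open>Fixed points of the path loop\<close>

definition factor_weight :: "bool \<Rightarrow> real \<Rightarrow> real" where
  "factor_weight b x = (if b then 1 / (x * (1 + x)) else 1 / (1 + x))"

lemma factor_pos: "x > 0 \<Longrightarrow> factor b x > 0"
  by (simp add: factor_def add_pos_pos)

lemma factor_log_deriv:
  assumes "x > 0"
  shows "has_log_deriv (factor b) (factor_weight b x) x"
proof (cases b)
  case True
  have "((\<lambda>x. inverse (inverse x + 1)) has_field_derivative 1 / (1 + x) ^ 2) (at x)"
    using assms add_pos_pos[of "inverse x" 1]
    by (auto intro!: derivative_eq_intros simp: field_simps power2_eq_square)
  moreover have "inverse (inverse x + 1) * (1 / (x * (1 + x))) = 1 / (1 + x) ^ 2"
  proof -
    have "inverse (inverse x + 1) = x / (1 + x)" using assms by (simp add: field_simps)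
    then show ?thesis using assms by (simp add: power2_eq_square)
  qed
  ultimately show ?thesis using True by (simp add: has_log_deriv_def factor_def[abs_def] factor_weight_def)
next
  case False
  have "((\<lambda>x. x + 1) has_field_derivative 1) (at x)" for x :: real
    by (auto intro!: derivative_eq_intros)
  then show ?thesis using assms False
    by (simp add: has_log_deriv_def factor_def[abs_def] factor_weight_def add.commute)
qed

text \<open>Inverting the minus coordinates makes the fixed point equations of both signs the same
  equation in \<open>z\<close>.\<close>

lemma path_loop_fixpoint_square:
  assumes pos: "\<And>k. k < n \<Longrightarrow> y k > 0"
    and fixpt: "\<And>i. i < n \<Longrightarrow> path_loop h n is_plus y i = y i"
    and alt: "\<And>i j. j \<in> nbrs n i \<Longrightarrow> i < n \<Longrightarrow> is_plus j \<longleftrightarrow> \<not> is_plus i"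
    and z: "\<And>i. i < n \<Longrightarrow> z i = (if is_plus i then y i else inverse (y i))"
    and i: "i < n"
  shows "z i ^ 2 = (\<Prod>j\<in>nbrs n i. h (z j))"
proof -
  have half: "half_loop h n y j = inverse (y j)" if "j < n" "\<not> is_plus j" for j
    using fixpt[OF that(1)] that(2) by (simp add: path_loop_def) (metis inverse_inverse_eq)
  have y: "y i \<noteq> 0" using pos[OF i] by simp
  show ?thesis
  proof (cases "is_plus i")
    case True
    have "(\<Prod>j\<in>nbrs n i. h (half_loop h n y j)) = (\<Prod>j\<in>nbrs n i. h (z j))"
      using alt[OF _ i] True nbrs_less by (intro prod.cong refl) (simp add: half z)
    then have "inverse (y i) * (\<Prod>j\<in>nbrs n i. h (z j)) = y i"
      using fixpt[OF i] True by (simp add: path_loop_def)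
    then show ?thesis using y True i by (simp add: z field_simps power2_eq_square)
  next
    case False
    have "(\<Prod>j\<in>nbrs n i. h (y j)) = (\<Prod>j\<in>nbrs n i. h (z j))"
      using alt[OF _ i] False nbrs_less by (intro prod.cong refl) (simp add: z)
    then have "y i * (\<Prod>j\<in>nbrs n i. h (z j)) = inverse (y i)"
      using half[OF i False] by (simp add: half_loop_def)
    then show ?thesis using y False i by (simp add: z field_simps power2_eq_square)
  qed
qed

text \<open>For sinks \<open>factor b z\<close> is \<open>1 + z\<close>; for sources it is the
  inverse of \<open>1 + 1 / z\<close>. So \<open>v = z\<close> or \<open>v = 1 / z\<close> solves
  the constant Y-system, and in both cases the weight is \<open>v / (1 + v)\<close>.\<close>

lemma path_loop_fixpoint_weight:
  assumes pos: "\<And>k. k < n \<Longrightarrow> y k > 0"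
    and fixpt: "\<And>i. i < n \<Longrightarrow> path_loop (factor b) n is_plus y i = y i"
    and alt: "\<And>i j. j \<in> nbrs n i \<Longrightarrow> i < n \<Longrightarrow> is_plus j \<longleftrightarrow> \<not> is_plus i"
    and z: "\<And>i. i < n \<Longrightarrow> z i = (if is_plus i then y i else inverse (y i))"
    and i: "i < n"
  shows "z i * factor_weight b (z i) = path_weight (pi / real (n + 3)) (Suc i)"
proof -
  have zpos: "z i > 0" if "i < n" for i using pos[OF that] that by (simp add: z)
  \<comment> \<open>Indices are shifted by one to make room for the boundary value 0 at each
    end.\<close>
  define v where "v k = (if k = 0 \<or> n < k then 0 else if b then inverse (z (k - 1)) else z (k - 1))" for k
  have v: "v (Suc k) = (if b then inverse (z k) else z k)" if "k < n" for k
    using that by (simp add: v_def)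
  have "v (Suc k) ^ 2 = (1 + v k) * (1 + v (Suc (Suc k)))" if k: "k < n" for k
  proof -
    have "z k ^ 2 = (\<Prod>j\<in>nbrs n k. factor b (z j))"
      by (rule path_loop_fixpoint_square[OF pos fixpt alt z k])
    then have "v (Suc k) ^ 2 = (\<Prod>j\<in>nbrs n k. if b then inverse (factor b (z j)) else factor b (z j))"
      using k by (simp add: v power_inverse prod_inversef[symmetric] o_def)
    also have "\<dots> = (\<Prod>j\<in>nbrs n k. 1 + v (Suc j))"
      by (intro prod.cong refl) (auto simp: v factor_def dest: nbrs_less)
    also have "\<dots> = (1 + v k) * (1 + v (Suc (Suc k)))"
      unfolding prod_nbrs[OF k] using k by (auto simp: v_def)
    finally show ?thesis .
  qed
  then have "v (Suc i) / (1 + v (Suc i)) = sin (real (Suc i) * (pi / real (n + 3))) *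
      sin (real (i + 3) * (pi / real (n + 3))) / sin (real (i + 2) * (pi / real (n + 3))) ^ 2"
    using i zpos by (intro constant_Y_system_solution) (simp_all add: v_def)
  moreover have "Suc i + 2 = i + 3" "Suc i + 1 = i + 2" by simp_all
  ultimately have "v (Suc i) / (1 + v (Suc i)) = path_weight (pi / real (n + 3)) (Suc i)"
    by (simp only: path_weight_def)
  moreover have "z i * factor_weight b (z i) = v (Suc i) / (1 + v (Suc i))"
  proof -
    have "1 / (1 + z i) = inverse (z i) / (1 + inverse (z i))"
      using zpos[OF i] by (simp add: divide_simps add.commute)
    then have "z i * factor_weight True (z i) = inverse (z i) / (1 + inverse (z i))"
      using zpos[OF i] by (simp add: factor_weight_def)
    moreover have "z i * factor_weight False (z i) = z i / (1 + z i)"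
      by (simp add: factor_weight_def)
    ultimately show ?thesis using i by (cases b) (simp_all only: v if_True if_False)
  qed
  ultimately show ?thesis by simp
qed

lemma char_poly_path_jacobian:
  assumes pos: "\<And>k. k < n \<Longrightarrow> y k > 0"
    and fixpt: "\<And>i. i < n \<Longrightarrow> path_loop (factor b) n is_plus y i = y i"
    and alt: "\<And>i j. j \<in> nbrs n i \<Longrightarrow> i < n \<Longrightarrow> is_plus j \<longleftrightarrow> \<not> is_plus i"
  shows "char_poly (map_mat complex_of_real (path_jacobian (factor b) n is_plus y))
    = (\<Prod>m=2..n+1. zeta_factor (n + 3) (int m))"
proof -
  define \<theta> where "\<theta> = pi / real (n + 3)"
  define z where "z i = (if is_plus i then y i else inverse (y i))" for i
  let ?c = "\<lambda>m. cis (2 * pi * real m / real (n + 3))"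
  let ?M = "map_mat complex_of_real (path_jacobian (factor b) n is_plus y)"
  have s: "sin (real i * \<theta>) \<noteq> 0" if "1 \<le> i" "i \<le> n + 2" for i
    using sin_multiple_pos[of i "n + 3"] that by (simp add: \<theta>_def)
  have N\<theta>: "real (n + 3) * \<theta> = pi" by (simp add: \<theta>_def)
  have inj: "inj_on ?c {2..n+1}"
    using bij_betw_imp_inj_on[OF bij_betw_roots_unity[of "n + 3"]] by (rule inj_on_subset) auto
  have "char_poly ?M = (\<Prod>a\<in>?c ` {2..n+1}. [:- a, 1:])"
  proof (rule char_poly_distinct_eigenvalues)
    show "?M \<in> carrier_mat n n" by (simp add: path_jacobian_def)
    show "card (?c ` {2..n+1}) = n" unfolding card_image[OF inj] by simp
    fix a assume "a \<in> ?c ` {2..n+1}"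
    then obtain m where m: "2 \<le> m" "m \<le> n + 1" "a = ?c m" by auto
    define \<psi> where "\<psi> = real m * \<theta>"
    define w where "w i = path_mode \<theta> \<psi> (i + 1)" for i
    define p where "p i = path_weight \<theta> (i + 1)" for i
    have "real (n + 3) * \<psi> = real m * pi" using N\<theta> by (simp only: \<psi>_def mult.left_commute)
    then have s\<psi>: "sin (real (n + 3) * \<psi>) = 0" by (simp only: sin_npi)
    have "eigenvalue ?M (cis (2 * \<psi>))"
    proof (rule path_jacobian_eigenvalue[where z = z and p = p and w = w and e = "factor_weight b"])
      show "z i = (if is_plus i then y i else inverse (y i))" for i by (simp add: z_def)
      show "p i = z i * factor_weight b (z i)" if "i < n" for i
        using path_loop_fixpoint_weight[OF pos fixpt alt z_def that] by (simp add: p_def \<theta>_def)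
      show "(\<Sum>j\<in>nbrs n i. p j * w j) = 2 * cos \<psi> * w i" if "i < n" for i
      proof -
        have "sin (real (n + 3) * \<theta>) = 0" unfolding N\<theta> by simp
        from path_mode_eigen[OF s this s\<psi> that]
        show ?thesis unfolding sum_nbrs[OF that] by (simp add: p_def w_def cong: if_cong)
      qed
      show "w 0 \<noteq> 0" using path_mode_nonzero[OF m(1,2)] by (simp add: w_def \<psi>_def \<theta>_def)
      show "n > 0" using m by simp
    qed (use pos fixpt alt factor_log_deriv factor_pos in auto)
    then show "eigenvalue ?M a" using m(3) by (simp add: \<psi>_def \<theta>_def mult_ac)
  qed simp
  also have "\<dots> = (\<Prod>m=2..n+1. zeta_factor (n + 3) (int m))"
    unfolding prod.reindex[OF inj] by (simp add: zeta_factor_def o_def)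
  finally show ?thesis .
qed

section \<open>Both cases as one path\<close>

locale path_case =
  fixes b :: bool and r l :: nat and s t :: "nat \<Rightarrow> int"
  assumes rl: "r \<ge> 1" "l \<ge> 2" "if b then r = 1 else l = 2"
    and signs: "bipartite_signs r s" "bipartite_signs (l - 1) t"
begin

definition n :: nat where "n = r * (l - 1)"

definition is_plus :: "nat \<Rightarrow> bool" where
  "is_plus p \<longleftrightarrow> s (fst (vertex_of l p)) * t (snd (vertex_of l p)) = 1"

lemma n_eq: "n = (if b then l - 1 else r)"
  unfolding n_def using rl by (auto split: if_splits)

lemma vertex_of_eq: "p < n \<Longrightarrow> vertex_of l p = (if b then (1, p + 1) else (p + 1, 1))"
  using rl by (auto simp: n_def vertex_of_def split: if_splits)

lemma bij: "bij_betw (vertex_of l) {..<n} (vertices r l)"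
  unfolding n_def by (rule bij_betw_vertex_of)

lemma vertex_of_in: "p < n \<Longrightarrow> vertex_of l p \<in> vertices r l"
  using bij by (auto simp: bij_betw_def)

lemma vertices_E:
  assumes "i \<in> vertices r l"
  obtains p where "p < n" "i = vertex_of l p"
  using assms bij by (auto simp: bij_betw_def)

lemma vertex_of_inj: "p < n \<Longrightarrow> q < n \<Longrightarrow> vertex_of l p = vertex_of l q \<longleftrightarrow> p = q"
  using bij by (auto simp: bij_betw_def dest: inj_onD)

lemma sign_values:
  assumes "p < n"
  shows "s (fst (vertex_of l p)) * t (snd (vertex_of l p)) = (if is_plus p then 1 else -1)"
proof -
  have "fst (vertex_of l p) \<in> {1..r}" "snd (vertex_of l p) \<in> {1..l - 1}"
    using vertex_of_in[OF assms] by (auto simp: vertices_def)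
  then have "s (fst (vertex_of l p)) = 1 \<or> s (fst (vertex_of l p)) = -1"
    "t (snd (vertex_of l p)) = 1 \<or> t (snd (vertex_of l p)) = -1"
    using signs unfolding bipartite_signs_def by blast+
  then show ?thesis by (auto simp: is_plus_def)
qed

lemma is_plus_alternates:
  assumes "j \<in> nbrs n i" "i < n"
  shows "is_plus j \<longleftrightarrow> \<not> is_plus i"
proof -
  have j: "j < n" and adj: "\<bar>int j - int i\<bar> = 1" using assms by (auto simp: nbrs_def)
  have opp: "s x = - s x'" if "x \<in> {1..r}" "x' \<in> {1..r}" "\<bar>int x - int x'\<bar> = 1" for x x'
    using signs(1) that unfolding bipartite_signs_def by blast
  have opp': "t x = - t x'" if "x \<in> {1..l-1}" "x' \<in> {1..l-1}" "\<bar>int x - int x'\<bar> = 1" for x x'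
    using signs(2) that unfolding bipartite_signs_def by blast
  have "s (fst (vertex_of l j)) * t (snd (vertex_of l j))
      = - (s (fst (vertex_of l i)) * t (snd (vertex_of l i)))"
  proof (cases b)
    case True
    then have "n = l - 1" by (simp add: n_eq)
    then show ?thesis using opp'[of "j + 1" "i + 1"] adj j assms(2) True
      by (simp add: vertex_of_eq)
  next
    case False
    then have "n = r" by (simp add: n_eq)
    then show ?thesis using opp[of "j + 1" "i + 1"] adj j assms(2) False
      by (simp add: vertex_of_eq)
  qed
  then show ?thesis using sign_values[OF j] sign_values[OF assms(2)] by (auto split: if_splits)
qed

abbreviation Q :: "vertex quiver" where "Q \<equiv> quiver_A r l s t"

text \<open>For \<open>r = 1\<close> arrows run from plus to minus vertices, for
  \<open>l = 2\<close> from minus to plus. So \<open>b\<close> records whether the plus vertices,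
  which are mutated first, are sources.\<close>

lemma quiver_path:
  assumes "p < n" "q < n"
  shows "Q (vertex_of l p) (vertex_of l q) = (if q \<in> nbrs n p \<and> (is_plus p \<longleftrightarrow> b) then 1 else 0)"
proof -
  have adj: "q \<in> nbrs n p \<longleftrightarrow> \<bar>int p - int q\<bar> = 1" using assms by (auto simp: nbrs_def)
  obtain a m where c: "vertex_of l p = (a, m)" by (cases "vertex_of l p")
  obtain a' m' where c': "vertex_of l q = (a', m')" by (cases "vertex_of l q")
  have sg: "s a * t m = (if is_plus p then 1 else -1)" using sign_values[OF assms(1)] c by simp
  have "a = a' \<and> \<bar>int m - int m'\<bar> = 1 \<longleftrightarrow> b \<and> \<bar>int p - int q\<bar> = 1"
    "m = m' \<and> \<bar>int a - int a'\<bar> = 1 \<longleftrightarrow> \<not> b \<and> \<bar>int p - int q\<bar> = 1"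
    using c c' vertex_of_eq assms by (auto split: if_splits)
  moreover have "(a, m) \<in> vertices r l" "(a', m') \<in> vertices r l"
    using vertex_of_in assms c c' by metis+
  ultimately show ?thesis unfolding c c' adj
    by (auto simp: quiver_A_def signed_vertices_def sg)
qed

lemma quiver_out: "i \<notin> vertices r l \<or> j \<notin> vertices r l \<Longrightarrow> Q i j = 0"
  using is_quiver_quiver_A[OF signs] unfolding is_quiver_def by metis

lemma is_source_vertex_of:
  assumes "p < n"
  shows "is_source_or_sink (if is_plus p then b else \<not> b) Q (vertex_of l p)"
proof -
  have "Q i (vertex_of l p) = 0" if "is_plus p \<longleftrightarrow> b" for i
  proof (cases "i \<in> vertices r l")
    case True
    then obtain q where q: "q < n" "i = vertex_of l q" by (rule vertices_E)
    show ?thesis using is_plus_alternates[of p q] that assms q by (auto simp: quiver_path)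
  qed (simp add: quiver_out)
  moreover have "Q (vertex_of l p) i = 0" if "is_plus p \<longleftrightarrow> \<not> b" for i
  proof (cases "i \<in> vertices r l")
    case True
    then obtain q where q: "q < n" "i = vertex_of l q" by (rule vertices_E)
    show ?thesis using that assms q by (auto simp: quiver_path)
  qed (simp add: quiver_out)
  ultimately show ?thesis unfolding is_source_or_sink_def by metis
qed

lemma edge_total:
  assumes "p < n" "q < n"
  shows "Q (vertex_of l p) (vertex_of l q) + Q (vertex_of l q) (vertex_of l p)
    = (if q \<in> nbrs n p then 1 else 0)"
proof -
  have "q \<in> nbrs n p \<longleftrightarrow> p \<in> nbrs n q" using assms by (auto simp: nbrs_def)
  then show ?thesis using assms is_plus_alternates[of q p] by (auto simp: quiver_path)
qed

lemma signed_vertices_image: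
  "signed_vertices r l s t 1 = vertex_of l ` {p. p < n \<and> is_plus p}"
  "signed_vertices r l s t (-1) = vertex_of l ` {p. p < n \<and> \<not> is_plus p}"
proof -
  have "signed_vertices r l s t e
      = vertex_of l ` {p. p < n \<and> s (fst (vertex_of l p)) * t (snd (vertex_of l p)) = e}" for e
  proof (rule Set.set_eqI)
    fix i
    have "i \<in> signed_vertices r l s t e \<longleftrightarrow> i \<in> vertex_of l ` {..<n} \<and> s (fst i) * t (snd i) = e"
      using bij by (cases i) (simp add: signed_vertices_def bij_betw_def)
    then show "i \<in> signed_vertices r l s t e \<longleftrightarrow>
        i \<in> vertex_of l ` {p. p < n \<and> s (fst (vertex_of l p)) * t (snd (vertex_of l p)) = e}"
      by auto
  qed
  moreover have
    "{p. p < n \<and> s (fst (vertex_of l p)) * t (snd (vertex_of l p)) = 1} = {p. p < n \<and> is_plus p}"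
    "{p. p < n \<and> s (fst (vertex_of l p)) * t (snd (vertex_of l p)) = -1} = {p. p < n \<and> \<not> is_plus p}"
    by (auto simp: sign_values split: if_splits)
  ultimately show "signed_vertices r l s t 1 = vertex_of l ` {p. p < n \<and> is_plus p}"
    "signed_vertices r l s t (-1) = vertex_of l ` {p. p < n \<and> \<not> is_plus p}"
    by simp_all
qed

text \<open>Vertices not adjacent to \<open>p\<close> enter with exponent 0, neighbours with
  exponent 1.\<close>

lemma prod_edges:
  fixes g :: "vertex \<Rightarrow> real"
  assumes p: "p < n" and P: "\<And>k. k \<in> nbrs n p \<Longrightarrow> P k"
  shows "(\<Prod>k\<in>vertex_of l ` {q. q < n \<and> P q}. g k ^ (Q (vertex_of l p) k + Q k (vertex_of l p)))
    = (\<Prod>k\<in>nbrs n p. g (vertex_of l k))"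
proof -
  have inj: "inj_on (vertex_of l) {q. q < n \<and> P q}"
    using vertex_of_inj by (auto intro!: inj_onI)
  have "(\<Prod>k\<in>vertex_of l ` {q. q < n \<and> P q}. g k ^ (Q (vertex_of l p) k + Q k (vertex_of l p)))
      = (\<Prod>q | q < n \<and> P q. g (vertex_of l q) ^ (if q \<in> nbrs n p then 1 else 0))"
    unfolding prod.reindex[OF inj] o_def using p by (intro prod.cong refl) (simp add: edge_total)
  also have "\<dots> = (\<Prod>q\<in>nbrs n p. g (vertex_of l q))"
    using P by (intro prod.mono_neutral_cong_right) (auto dest: nbrs_less)
  finally show ?thesis .
qed

lemma eval_cluster_transformation:
  assumes ks: "ks \<in> loop_orders r l s t" and y: "\<And>i. i \<in> vertices r l \<Longrightarrow> y i > 0" and p: "p < n"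
  shows "eval_ratfun y (cluster_transformation r l s t ks (vertex_of l p))
    = path_loop (factor b) n is_plus (\<lambda>q. y (vertex_of l q)) p"
proof -
  let ?c = "vertex_of l"
  let ?P = "{q. q < n \<and> is_plus q}" and ?M = "{q. q < n \<and> \<not> is_plus q}"
  obtain ps ms where pm: "ks = ps @ ms" "distinct ps" "set ps = ?c ` ?P" "distinct ms" "set ms = ?c ` ?M"
    using ks by (auto simp: loop_orders_def signed_vertices_image)
  define T where "T i = y i * (\<Prod>k\<in>set ps. factor b (y k) ^ (Q i k + Q k i))" for i
  have im: "vertices r l = ?c ` {..<n}" using bij by (simp add: bij_betw_def)
  have mem: "?c q \<in> set ps \<longleftrightarrow> is_plus q" if "q < n" for q
    using that vertex_of_inj by (auto simp: pm)
  have ev: "eval_ratfun y (cluster_transformation r l s t ks (?c p)) =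
    (if ?c p \<in> set ps then inverse (y (?c p)) *
        (\<Prod>k\<in>set ms. factor b (T k) ^ (Q (?c p) k + Q k (?c p)))
     else inverse (T (?c p)))"
    unfolding cluster_transformation_def pm(1) T_def
  proof (rule eval_bipartite_loop[OF y is_quiver_quiver_A[OF signs] pm(2) _ _ pm(4)])
    show "set ps \<subseteq> vertices r l" using vertex_of_in by (auto simp: pm)
    show "set ms = vertices r l - set ps" using vertex_of_inj by (auto simp: pm im)
    show "is_source_or_sink b Q k" if "k \<in> set ps" for k
      using that is_source_vertex_of by (force simp: pm)
    show "is_source_or_sink (\<not> b) Q k" if "k \<in> set ms" for k
      using that is_source_vertex_of by (force simp: pm)
  qed (use vertex_of_in p in auto)
  have T: "T (?c q) = half_loop (factor b) n (\<lambda>q. y (?c q)) q" if "q < n" "\<not> is_plus q" for q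
    unfolding T_def half_loop_def pm(3) using that is_plus_alternates by (subst prod_edges) auto
  show ?thesis
  proof (cases "is_plus p")
    case True
    have "(\<Prod>k\<in>set ms. factor b (T k) ^ (Q (?c p) k + Q k (?c p)))
        = (\<Prod>k\<in>nbrs n p. factor b (T (?c k)))"
      unfolding pm(5) using p True is_plus_alternates by (subst prod_edges) auto
    also have "\<dots> = (\<Prod>k\<in>nbrs n p. factor b (half_loop (factor b) n (\<lambda>q. y (?c q)) k))"
    proof (intro prod.cong refl)
      fix k assume k: "k \<in> nbrs n p"
      then have "k < n" "\<not> is_plus k" using True is_plus_alternates[OF k p] nbrs_less by auto
      then show "factor b (T (?c k)) = factor b (half_loop (factor b) n (\<lambda>q. y (?c q)) k)"
        by (simp add: T)
    qed
    finally show ?thesis unfolding ev using True p by (simp add: mem path_loop_def)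
  next
    case False
    then show ?thesis unfolding ev using p by (simp add: mem path_loop_def T)
  qed
qed

lemma jacobian_eq:
  assumes ks: "ks \<in> loop_orders r l s t" and y: "\<And>i. i \<in> vertices r l \<Longrightarrow> y i > 0"
  shows "jacobian r l (cluster_transformation r l s t ks) y
    = path_jacobian (factor b) n is_plus (\<lambda>q. y (vertex_of l q))"
proof (rule eq_matI)
  fix p q assume "p < dim_row (path_jacobian (factor b) n is_plus (\<lambda>q. y (vertex_of l q)))"
    "q < dim_col (path_jacobian (factor b) n is_plus (\<lambda>q. y (vertex_of l q)))"
  then have pq: "p < n" "q < n" by (simp_all add: path_jacobian_def)
  let ?c = "vertex_of l"
  have "eval_ratfun (y(?c q := x)) (cluster_transformation r l s t ks (?c p))
      = path_loop (factor b) n is_plus ((\<lambda>q. y (?c q))(q := x)) p" if "x > 0" for x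
  proof -
    have "eval_ratfun (y(?c q := x)) (cluster_transformation r l s t ks (?c p))
        = path_loop (factor b) n is_plus (\<lambda>k. (y(?c q := x)) (?c k)) p"
      using y that by (intro eval_cluster_transformation ks pq) auto
    also have "\<dots> = path_loop (factor b) n is_plus ((\<lambda>q. y (?c q))(q := x)) p"
      using pq by (auto simp: path_loop_def half_loop_def vertex_of_inj nbrs_less cong: prod.cong)
    finally show ?thesis .
  qed
  \<comment> \<open>The evaluation formula is available at positive points; these form a
    neighbourhood of the point of differentiation, which is enough for the derivative.\<close>
  moreover have "\<forall>\<^sub>F x in nhds (y (?c q)). x > 0"
    using y[OF vertex_of_in[OF pq(2)]] eventually_nhds_in_open[of "{0<..}" "y (?c q)"] by simp
  ultimately have "\<forall>\<^sub>F x in nhds (y (?c q)). eval_ratfun (y(?c q := x)) (cluster_transformation r l s t ks (?c p))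
      = path_loop (factor b) n is_plus ((\<lambda>q. y (?c q))(q := x)) p"
    by (auto elim: eventually_mono)
  then have "deriv (\<lambda>x. eval_ratfun (y(?c q := x)) (cluster_transformation r l s t ks (?c p))) (y (?c q))
      = deriv (\<lambda>x. path_loop (factor b) n is_plus ((\<lambda>q. y (?c q))(q := x)) p) (y (?c q))"
    by (rule deriv_cong_ev) simp
  then show "jacobian r l (cluster_transformation r l s t ks) y $$ (p, q)
      = path_jacobian (factor b) n is_plus (\<lambda>q. y (?c q)) $$ (p, q)"
    using pq by (simp add: jacobian_def path_jacobian_def n_def)
qed (simp_all add: jacobian_def path_jacobian_def n_def)

lemma char_poly_jacobian:
  assumes "ks \<in> loop_orders r l s t" "\<And>i. i \<in> vertices r l \<Longrightarrow> y i > 0"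
    and "\<And>i. i \<in> vertices r l \<Longrightarrow> eval_ratfun y (cluster_transformation r l s t ks i) = y i"
  shows "N_poly r l = D_poly r l *
    char_poly (map_mat complex_of_real (jacobian r l (cluster_transformation r l s t ks) y))"
proof -
  have "char_poly (map_mat complex_of_real (jacobian r l (cluster_transformation r l s t ks) y))
      = (\<Prod>m=2..n+1. zeta_factor (n + 3) (int m))"
  proof -
    have jac: "jacobian r l (cluster_transformation r l s t ks) y
        = path_jacobian (factor b) n is_plus (\<lambda>q. y (vertex_of l q))"
      using assms(1,2) by (rule jacobian_eq)
    show ?thesis unfolding jac
    proof (rule char_poly_path_jacobian)
      show "path_loop (factor b) n is_plus (\<lambda>q. y (vertex_of l q)) i = y (vertex_of l i)" if "i < n" for i
        using eval_cluster_transformation[of ks y i] assms(1,2) that assms(3)[OF vertex_of_in[OF that]] by simp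
    qed (use assms(2) vertex_of_in is_plus_alternates in auto)
  qed
  moreover have "N_poly r l = D_poly r l * (\<Prod>m=2..n+1. zeta_factor (n + 3) (int m))"
  proof (cases b)
    case True
    then have "r = 1" "n = l - 1" using rl n_eq by simp_all
    then have eqs: "n + 1 = l" "n + 3 = l + 2" using rl(2) by linarith+
    show ?thesis
      unfolding eqs using N_poly_eq_D_poly_mult_rank_1[OF rl(2)] \<open>r = 1\<close> by simp
  next
    case False
    then have "l = 2" "n = r" using rl n_eq by simp_all
    then show ?thesis using N_poly_eq_D_poly_mult_level_2[of r] by simp
  qed
  ultimately show ?thesis by simp
qed

end

theorem theorem1p2:
  fixes r l :: nat
    and s t :: "nat \<Rightarrow> int"
    and ks :: "vertex list"
    and \<eta> :: "vertex \<Rightarrow> real"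
  assumes "(r = 1 \<and> l \<ge> 2) \<or> (r \<ge> 1 \<and> l = 2)"
    and "bipartite_signs r s" and "bipartite_signs (l - 1) t"
    and "ks \<in> loop_orders r l s t"
    and "\<And>i. i \<in> vertices r l \<Longrightarrow> \<eta> i > 0"
    and "\<And>i. i \<in> vertices r l \<Longrightarrow>
           eval_ratfun \<eta> (cluster_transformation r l s t ks i) = \<eta> i"
  shows "to_fract (char_poly (map_mat complex_of_real
             (jacobian r l (cluster_transformation r l s t ks) \<eta>)))
         = to_fract (N_poly r l) / to_fract (D_poly r l)"
proof -
  \<comment> \<open>For \<open>r = 1\<close> and \<open>l = 2\<close> the quiver is a single vertex;
    that case is treated here as rank 1.\<close>
  interpret path_case "r = 1" r l s t
    using assms(1-3) by unfold_locales auto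
  have "N_poly r l = D_poly r l *
      char_poly (map_mat complex_of_real (jacobian r l (cluster_transformation r l s t ks) \<eta>))"
    using assms(4-6) by (rule char_poly_jacobian)
  \<comment> \<open>The polynomial identity becomes a quotient in the fraction field.\<close>
  then show ?thesis using D_poly_nonzero[of r l] by simp
qed

end
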